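(* Let $p:\mathbb{R}^2\to\mathbb{R}$ be a measurable function with $1<p_-\le p_+<\infty$, let $0\le\alpha<\frac{1}{p_+}$ be a constant, and set $q(x)=\frac{p(x)}{1-\alpha\, p(x)}$ for $x\in\mathbb{R}^2$. Then the operator $M^S_\alpha$ is bounded from $L^{p(\cdot)}(\mathbb{R}^2)$ to $L^{q(\cdot)}(\mathbb{R}^2)$ if and only if $p$ is constant (almost everywhere).
   Context: $p_-=\inf_{\mathbb{R}^2}p$ and $p_+=\sup_{\mathbb{R}^2}p$. For a measurable exponent $r:\mathbb{R}^2\to[1,\infty)$ with $r_+<\infty$, $L^{r(\cdot)}(\mathbb{R}^2)$ is the space of measurable $f:\mathbb{R}^2\to\mathbb{R}$ with $\|f\|_{L^{r(\cdot)}}=\inf\{\lambda>0:\int_{\mathbb{R}^2}|f(x)/\lambda|^{r(x)}\,dx\le 1\}<\infty$. The strong fractional maximal operator is $$(M^S_\alpha f)(x,y)=\sup_{I\ni x,\ J\ni y}|I\times J|^{\alpha-1}\iint_{I\times J}|f(t,\tau)|\,dt\,d\tau,\qquad (x,y)\in\mathbb{R}^2,$$ where the supremum is over all bounded intervals (of positive length) $I\ni x$, $J\ni y$ in $\mathbb{R}$. Bounded means that there is a constant $c>0$ with $\|M^S_\alpha f\|_{L^{q(\cdot)}}\le c\|f\|_{L^{p(\cdot)}}$ for all $f\in L^{p(\cdot)}(\mathbb{R}^2)$. *)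

theory Defs
  imports "HOL-Analysis.Analysis"
begin

text \<open>
  The infimum and supremum of an exponent are pointwise (not essential), and taken in
  \<^typ>\<open>ereal\<close> so that they are meaningful without a boundedness assumption.
\<close>

definition exponent_inf :: "(real \<times> real \<Rightarrow> real) \<Rightarrow> ereal" where
  "exponent_inf p = (INF z. ereal (p z))"

definition exponent_sup :: "(real \<times> real \<Rightarrow> real) \<Rightarrow> ereal" where
  "exponent_sup p = (SUP z. ereal (p z))"

text \<open>Only used for exponents \<open>r > 0\<close>, where \<open>\<infinity>\<close> to the power \<open>r\<close> is \<open>\<infinity>\<close>.\<close>

definition ennreal_powr :: "ennreal \<Rightarrow> real \<Rightarrow> ennreal" where
  "ennreal_powr a r = (if a = \<infinity> then \<infinity> else ennreal (enn2real a powr r))"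

text \<open>
  The Luxemburg norm is defined on \<open>[0,\<infinity>]\<close>-valued functions, because a maximal function may
  take the value \<open>\<infinity>\<close>; the norm of a real function \<open>f\<close> is that of \<open>\<bar>f\<bar>\<close>. The infimum is taken in
  \<^typ>\<open>ennreal\<close>, so the norm is \<open>\<infinity>\<close> if no \<open>t\<close> is admissible.
\<close>

definition var_lux_norm :: "(real \<times> real \<Rightarrow> real) \<Rightarrow> (real \<times> real \<Rightarrow> ennreal) \<Rightarrow> ennreal" where
  "var_lux_norm r g =
     Inf {ennreal t | t::real. t > 0 \<and>
       (\<integral>\<^sup>+ z. ennreal_powr (g z / ennreal t) (r z) \<partial>lebesgue) \<le> 1}"

definition var_norm :: "(real \<times> real \<Rightarrow> real) \<Rightarrow> (real \<times> real \<Rightarrow> real) \<Rightarrow> ennreal" where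
  "var_norm r f = var_lux_norm r (\<lambda>z. ennreal \<bar>f z\<bar>)"

definition var_Lp :: "(real \<times> real \<Rightarrow> real) \<Rightarrow> (real \<times> real \<Rightarrow> real) set" where
  "var_Lp r = {f \<in> borel_measurable lebesgue. var_norm r f < \<infinity>}"

text \<open>Open, half-open and closed intervals are all admitted.\<close>

definition nondeg_interval :: "real set \<Rightarrow> bool" where
  "nondeg_interval I \<longleftrightarrow> is_interval I \<and> bounded I \<and> 0 < measure lebesgue I"

definition strong_frac_maximal ::
    "real \<Rightarrow> (real \<times> real \<Rightarrow> real) \<Rightarrow> real \<times> real \<Rightarrow> ennreal" where
  "strong_frac_maximal \<alpha> f = (\<lambda>(x, y).
     Sup {ennreal (measure lebesgue (I \<times> J) powr (\<alpha> - 1)) *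
            (\<integral>\<^sup>+ z \<in> I \<times> J. ennreal \<bar>f z\<bar> \<partial>lebesgue) | I J.
          nondeg_interval I \<and> nondeg_interval J \<and> x \<in> I \<and> y \<in> J})"

definition strong_frac_maximal_bounded ::
    "real \<Rightarrow> (real \<times> real \<Rightarrow> real) \<Rightarrow> (real \<times> real \<Rightarrow> real) \<Rightarrow> bool" where
  "strong_frac_maximal_bounded \<alpha> p q \<longleftrightarrow>
     (\<exists>c::real. c > 0 \<and>
        (\<forall>f \<in> var_Lp p. var_lux_norm q (strong_frac_maximal \<alpha> f) \<le> ennreal c * var_norm p f))"

end

theory Submission
  imports Defs
begin

text \<open>
  If \<open>p\<close> is a constant \<open>k\<close>, a trick of Hedberg removes \<open>\<alpha>\<close>. Let \<open>A\<close> be the mean of \<open>\<bar>f\<bar>\<close> over a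
  rectangle of area \<open>r\<close>. If \<open>f\<close> has \<open>k\<close>-modular at most \<open>1\<close>, then \<open>A \<le> 2 r powr (-1/k)\<close>, so large
  means live on small rectangles and \<open>r powr \<alpha> * A \<le> 2 A powr (1 - \<alpha> k)\<close>. As \<open>1 - \<alpha> k = k / q\<close>,
  the \<open>q\<close>-modular of the fractional maximal function is controlled by the \<open>k\<close>-modular of the
  ordinary strong maximal function, and the latter is dominated by the one-dimensional
  Hardy--Littlewood operator applied in each variable in turn. The one-dimensional operator is
  bounded on \<open>L\<^sup>k\<close> by the Vitali covering lemma and integration over the levels
  (\<open>HL_maximal_weak_type\<close>, \<open>HL_maximal_strong_type\<close>), and Tonelli's theorem does the rest
  (\<open>iterated_maximal_strong_type\<close>, \<open>strong_frac_maximal_bounded_const\<close>).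

  Conversely, suppose that \<open>p \<le> s\<close> on \<open>E\<close> and \<open>p \<ge> u > s\<close> on \<open>F\<close>, and that some rectangles \<open>R\<close> of
  area tending to \<open>0\<close> meet both \<open>E\<close> and \<open>F\<close> in a fixed proportion of their area. The function
  \<open>\<chi>\<^bsub>E \<inter> R\<^esub>\<close> has norm at most \<open>\<bar>R\<bar> powr (1/s)\<close>, but its maximal function is of order
  \<open>\<bar>R\<bar> powr \<alpha>\<close> on \<open>F \<inter> R\<close>, where the target exponent is large, and thus has norm at least of order
  \<open>\<bar>R\<bar> powr (1/u)\<close>. Since \<open>1/u < 1/s\<close>, no constant works for all these rectangles
  (\<open>rectangle_test_inequality\<close>, \<open>share_thin_rectangles_imp_unbounded\<close>).

  Such rectangles exist for every exponent that is not constant almost everywhere. Some values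
  \<open>s < t\<close> have both \<open>{p \<le> s}\<close> and \<open>{p \<ge> t}\<close> of positive measure; each of these fills three quarters
  of a rectangle, say \<open>K \<times> L\<close> and \<open>K' \<times> L'\<close>. In the corner \<open>K \<times> L'\<close> the exponent is on at least half
  of the area either below or above the midpoint of \<open>s\<close> and \<open>t\<close>. In both cases two rectangles with a
  common side carry sets on which \<open>p\<close> is separated by a gap, and cutting the common side repeatedly
  in half gives arbitrarily thin strips through both
  (\<open>share_thin_rectangles_horizontal\<close>, \<open>share_thin_rectangles_vertical\<close>,
  \<open>strong_frac_maximal_bounded_imp_const\<close>). The strips can be long and thin because the rectangles
  in the strong maximal operator have independent side lengths.
\<close>


section \<open>Real powers of extended nonnegative reals\<close>

lemma ennreal_mult_mult: "0 \<le> b \<Longrightarrow> ennreal a * (ennreal b * X) = ennreal (a * b) * X"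
  by (simp add: ennreal_mult'' mult.assoc)

lemma ennreal_powr_ennreal: "0 \<le> a \<Longrightarrow> ennreal_powr (ennreal a) r = ennreal (a powr r)"
  by (simp add: ennreal_powr_def)

lemma ennreal_powr_mono:
  assumes "a \<le> b" "0 \<le> r"
  shows "ennreal_powr a r \<le> ennreal_powr b r"
proof (cases "b = \<infinity>")
  case False
  then have "a < top" "b < top"
    using assms(1) by (auto simp: top.not_eq_extremum intro: le_less_trans)
  then show ?thesis
    using assms by (auto simp: ennreal_powr_def intro!: ennreal_leI powr_mono2 enn2real_mono)
qed (simp add: ennreal_powr_def)

lemma ennreal_powr_mult_left:
  assumes "0 < c"
  shows "ennreal_powr (ennreal c * a) r = ennreal (c powr r) * ennreal_powr a r"
  using assms
  by (cases a) (auto simp: ennreal_powr_def ennreal_mult'[symmetric] ennreal_mult_top powr_mult enn2real_mult)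

lemma ennreal_powr_powr: "ennreal_powr (ennreal_powr a r) s = ennreal_powr a (r * s)"
  by (cases a) (auto simp: ennreal_powr_def powr_powr)

lemma measurable_ennreal_powr [measurable]:
  "(\<lambda>a. ennreal_powr a r) \<in> borel_measurable borel"
  unfolding ennreal_powr_def by measurable

text \<open>
  The layer-cake formula for a single value. The exponent may lie between \<open>-1\<close> and \<open>0\<close>, which occurs
  for \<open>t powr (p - 2)\<close> with \<open>1 < p < 2\<close> in the proof of \<open>HL_maximal_strong_type\<close>.
\<close>

lemma nn_integral_powr_less:
  fixes s :: real
  assumes "-1 < s"
  shows "(\<integral>\<^sup>+ t. ennreal (t powr s) * indicator {t. 0 < t \<and> ennreal t < a} t \<partial>lborel)
       = ennreal (1 / (s + 1)) * ennreal_powr a (s + 1)" (is "?I a = _")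
proof -
  have fin: "?I (ennreal c) = ennreal (1 / (s + 1)) * ennreal_powr (ennreal c) (s + 1)" if "0 \<le> c" for c
  proof -
    have "?I (ennreal c) = (\<integral>\<^sup>+ t. ennreal (t powr s) * indicator {0..c} t \<partial>lborel)"
    proof (rule nn_integral_cong_AE)
      show "AE t in lborel. ennreal (t powr s) * indicator {t. 0 < t \<and> ennreal t < ennreal c} t
          = ennreal (t powr s) * indicator {0..c} t"
        using AE_lborel_singleton[of c]
      proof eventually_elim
        case (elim t)
        then show ?case
          by (cases "t = 0") (auto simp: indicator_def ennreal_less_iff)
      qed
    qed
    also have "\<dots> = ennreal (c powr (s + 1) / (s + 1))"
      using has_integral_powr_from_0[OF assms that]
      by (intro nn_integral_has_integral_lebesgue') auto
    also have "\<dots> = ennreal (1 / (s + 1)) * ennreal_powr (ennreal c) (s + 1)"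
      using assms that by (simp add: ennreal_powr_ennreal ennreal_mult'[symmetric])
    finally show ?thesis .
  qed
  show ?thesis
  proof (cases a)
    case (real c)
    then show ?thesis using fin by simp
  next
    case top
    have "?I top = top"
    proof (rule ccontr)
      assume "?I top \<noteq> top"
      then obtain x where x: "?I top = ennreal x" "0 \<le> x"
        by (cases "?I top") auto
      define c where "c = ((s + 1) * (x + 1)) powr (1 / (s + 1))"
      have "ennreal (x + 1) = ennreal (1 / (s + 1)) * ennreal_powr (ennreal c) (s + 1)"
        using assms x(2)
        by (simp add: ennreal_powr_ennreal ennreal_mult'[symmetric] c_def powr_powr)
      also have "\<dots> = ?I (ennreal c)"
        by (rule fin[symmetric]) (simp add: c_def)
      also have "\<dots> \<le> ?I top"
        by (intro nn_integral_mono) (auto simp: indicator_def)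
      finally show False
        using x by simp
    qed
    then show ?thesis
      using assms top by (simp add: ennreal_powr_def ennreal_mult_top)
  qed
qed

section \<open>The one-dimensional Hardy--Littlewood maximal operator\<close>

lemma emeasure_UN_countable_le:
  assumes [measurable]: "\<And>i. i \<in> I \<Longrightarrow> X i \<in> sets M" and I: "countable I"
  shows "emeasure M (\<Union>i\<in>I. X i) \<le> (\<integral>\<^sup>+i. emeasure M (X i) \<partial>count_space I)"
proof -
  have "(\<Union>i\<in>I. X i) \<in> sets M"
    using I by (intro sets.countable_UN') auto
  then have "emeasure M (\<Union>i\<in>I. X i) = (\<integral>\<^sup>+x. indicator (\<Union>i\<in>I. X i) x \<partial>M)"
    by simp
  also have "\<dots> \<le> (\<integral>\<^sup>+x. (\<integral>\<^sup>+i. indicator (X i) x \<partial>count_space I) \<partial>M)"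
  proof (rule nn_integral_mono)
    fix x
    show "indicator (\<Union>i\<in>I. X i) x \<le> (\<integral>\<^sup>+i. indicator (X i) x \<partial>count_space I)"
    proof (cases "\<exists>j\<in>I. x \<in> X j")
      case True
      then obtain j where j: "j \<in> I" "x \<in> X j" by blast
      have "(1::ennreal) \<le> (\<integral>\<^sup>+i. indicator (X i) x \<partial>count_space I)"
        using nn_integral_ge_point[OF j(1), of "\<lambda>i. indicator (X i) x"] j(2) by simp
      then show ?thesis
        using j by (auto simp: indicator_def)
    qed (auto simp: indicator_def)
  qed
  also have "\<dots> = (\<integral>\<^sup>+i. (\<integral>\<^sup>+x. indicator (X i) x \<partial>M) \<partial>count_space I)"
    by (intro nn_integral_count_space_nn_integral I) measurable
  also have "\<dots> = (\<integral>\<^sup>+i. emeasure M (X i) \<partial>count_space I)"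
    by (intro nn_integral_cong) simp
  finally show ?thesis .
qed

definition rat_intervals :: "(real \<times> real) set" where
  "rat_intervals = {(a, b). a \<in> \<rat> \<and> b \<in> \<rat> \<and> a < b}"

lemma countable_rat_intervals [simp]: "countable rat_intervals"
  by (rule countable_subset[of _ "\<rat> \<times> \<rat>"]) (auto simp: rat_intervals_def countable_rat)

text \<open>
  Rational end points turn the supremum into a countable one, which makes the operator preserve
  measurability, also with respect to parameters. An arbitrary interval lies in a rational one of
  at most twice its length, so only a constant factor is lost.
\<close>

definition HL_maximal :: "(real \<Rightarrow> ennreal) \<Rightarrow> real \<Rightarrow> ennreal" where
  "HL_maximal G x = (SUP (a, b) \<in> rat_intervals.
     indicator {a<..<b} x * ((\<integral>\<^sup>+ t\<in>{a<..<b}. G t \<partial>lborel) / ennreal (b - a)))"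

text \<open>
  The parameter \<open>w\<close> serves the two-dimensional case: the operator acts in one variable while the other
  one, and the point of evaluation, vary measurably.
\<close>

lemma measurable_HL_maximal:
  assumes [measurable]: "case_prod H \<in> borel_measurable (M \<Otimes>\<^sub>M lborel)" "g \<in> borel_measurable M"
  shows "(\<lambda>w. HL_maximal (H w) (g w)) \<in> borel_measurable M"
  unfolding HL_maximal_def
proof (intro borel_measurable_SUP countable_rat_intervals)
  fix k assume "k \<in> rat_intervals"
  obtain a b where k: "k = (a, b)" by (cases k)
  show "(\<lambda>w. case k of (a, b) \<Rightarrow> indicator {a<..<b} (g w) *
     ((\<integral>\<^sup>+ t\<in>{a<..<b}. H w t \<partial>lborel) / ennreal (b - a))) \<in> borel_measurable M"
    unfolding k by simp measurable
qed

text \<open>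
  If the mean of \<open>G\<close> over an interval exceeds \<open>2 l\<close>, then the part of \<open>G\<close> below \<open>l\<close> accounts for at most half
  of it, so the integral of the part above \<open>l\<close> is at least \<open>l\<close> times the length. The Vitali covering
  lemma selects disjoint intervals of this kind whose fivefold enlargements cover the level set.
  Having only the large part of \<open>G\<close> on the right is what makes the strong type estimate follow
  by integration over \<open>l\<close>.
\<close>

lemma HL_maximal_weak_type:
  assumes [measurable]: "G \<in> borel_measurable borel" and l: "0 < l"
  shows "emeasure lborel {x. ennreal (2 * l) < HL_maximal G x}
    \<le> ennreal (5 / l) * (\<integral>\<^sup>+ t. G t * indicator {t. ennreal l < G t} t \<partial>lborel)"
proof -
  define G1 where "G1 t = G t * indicator {t. ennreal l < G t} t" for t
  have [measurable]: "G1 \<in> borel_measurable borel"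
    unfolding G1_def by measurable
  define X where "X = (\<integral>\<^sup>+ t. G1 t \<partial>lborel)"
  have "emeasure lborel {x. ennreal (2 * l) < HL_maximal G x} \<le> ennreal (5 / l) * X"
  proof (cases "X = top")
    case True
    then show ?thesis using l by (simp add: ennreal_mult_top)
  next
    case False
    then obtain x where x: "X = ennreal x" "0 \<le> x" by (cases X) auto
    define K where "K = {(a, b) \<in> rat_intervals. ennreal (2 * l) < (\<integral>\<^sup>+ t\<in>{a<..<b}. G t \<partial>lborel) / ennreal (b - a)}"
    have big: "ennreal (l * (b - a)) \<le> (\<integral>\<^sup>+ t\<in>{a<..<b}. G1 t \<partial>lborel)" if "(a, b) \<in> K" for a b
    proof -
      have ab: "a < b" using that by (auto simp: K_def rat_intervals_def)
      let ?Y = "\<integral>\<^sup>+ t\<in>{a<..<b}. G1 t \<partial>lborel"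
      have "ennreal (2 * l) \<le> (\<integral>\<^sup>+ t\<in>{a<..<b}. G t \<partial>lborel) / ennreal (b - a)"
        using that by (auto simp: K_def)
      then have "ennreal (2 * l) * ennreal (b - a)
          \<le> ((\<integral>\<^sup>+ t\<in>{a<..<b}. G t \<partial>lborel) / ennreal (b - a)) * ennreal (b - a)"
        by (rule mult_right_mono) simp
      then have "ennreal (2 * l * (b - a)) \<le> (\<integral>\<^sup>+ t\<in>{a<..<b}. G t \<partial>lborel)"
        using ab l by (simp add: ennreal_mult'' ennreal_divide_times mult_divide_eq_ennreal)
      also have "\<dots> \<le> (\<integral>\<^sup>+ t. ennreal l * indicator {a<..<b} t + G1 t * indicator {a<..<b} t \<partial>lborel)"
        by (intro nn_integral_mono) (auto simp: indicator_def G1_def not_less)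
      also have "\<dots> = ennreal (l * (b - a)) + ?Y"
        using ab l by (subst nn_integral_add) (auto simp: nn_integral_cmult ennreal_mult')
      finally have "ennreal (2 * l * (b - a)) \<le> ennreal (l * (b - a)) + ?Y" .
      then show ?thesis
        using ab l by (cases ?Y) (auto simp: ennreal_plus[symmetric] simp del: ennreal_plus)
    qed
    \<comment> \<open>centre and radius; \<open>bound\<close> supplies the bounded radii that the covering lemma requires\<close>
    define c where "c k = (fst k + snd k) / 2" for k :: "real \<times> real"
    define r where "r k = (snd k - fst k) / 2" for k :: "real \<times> real"
    have bound: "0 < r k \<and> r k \<le> x / l" if "k \<in> K" for k
    proof -
      obtain a b where k: "k = (a, b)" by (cases k)
      have ab: "a < b" using that by (auto simp: K_def rat_intervals_def k)
      have "ennreal (l * (b - a)) \<le> (\<integral>\<^sup>+ t\<in>{a<..<b}. G1 t \<partial>lborel)"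
        using big that k by blast
      also have "\<dots> \<le> X"
        unfolding X_def by (intro nn_integral_mono) (auto simp: indicator_def)
      finally have "l * (b - a) \<le> x" using x by simp
      moreover have "l * ((b - a) / 2) \<le> l * (b - a)" using ab l by simp
      ultimately have "l * ((b - a) / 2) \<le> x" by linarith
      then show ?thesis using ab l by (simp add: k r_def field_simps)
    qed
    obtain C where C: "countable C" "C \<subseteq> K"
      and disj: "pairwise (\<lambda>i j. disjnt (cball (c i) (r i))
           (cball (c j) (r j))) C"
      and cov: "\<And>i. i \<in> K \<Longrightarrow> \<exists>j. j \<in> C \<and>
           \<not> disjnt (cball (c i) (r i))
             (cball (c j) (r j)) \<and>
           cball (c i) (r i) \<subseteq> ball (c j) (5 * (r j))"
      using Vitali_covering_lemma_cballs_balls[of K r "x / l" c, OF bound] by blast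
    have cb: "{fst k<..<snd k} \<subseteq> cball (c k) (r k)" for k
      by (auto simp: dist_real_def abs_if c_def r_def field_simps)
    have "emeasure lborel {x. ennreal (2 * l) < HL_maximal G x}
      \<le> emeasure lborel (\<Union>j\<in>C. ball (c j) (5 * (r j)))"
    proof (rule emeasure_mono)
      show "{x. ennreal (2 * l) < HL_maximal G x} \<subseteq> (\<Union>j\<in>C. ball (c j) (5 * (r j)))"
      proof
        fix x assume "x \<in> {x. ennreal (2 * l) < HL_maximal G x}"
        then obtain k where k: "k \<in> rat_intervals" "ennreal (2 * l) < (case k of (a, b) \<Rightarrow> indicator {a<..<b} x * ((\<integral>\<^sup>+ t\<in>{a<..<b}. G t \<partial>lborel) / ennreal (b - a)))"
          unfolding HL_maximal_def less_SUP_iff by auto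
        obtain a b where ab: "k = (a, b)" by (cases k)
        have x: "x \<in> {a<..<b}"
          using k(2) unfolding ab by (cases "x \<in> {a<..<b}") auto
        then have "(a, b) \<in> K"
          using k unfolding ab K_def by simp
        with x show "x \<in> (\<Union>j\<in>C. ball (c j) (5 * (r j)))"
          using cov[of "(a, b)"] cb[of "(a, b)"] unfolding fst_conv snd_conv by blast
      qed
      show "(\<Union>j\<in>C. ball (c j) (5 * (r j))) \<in> sets lborel"
        by (simp add: open_UN)
    qed
    also have "\<dots> \<le> (\<integral>\<^sup>+ j. emeasure lborel (ball (c j) (5 * (r j))) \<partial>count_space C)"
      by (intro emeasure_UN_countable_le C) simp
    also have "\<dots> \<le> (\<integral>\<^sup>+ j. ennreal (5 / l) * (\<integral>\<^sup>+ t\<in>{fst j<..<snd j}. G1 t \<partial>lborel) \<partial>count_space C)"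
    proof (rule nn_integral_mono)
      fix j assume "j \<in> space (count_space C)"
      then have jK: "j \<in> K" using C by auto
      obtain a b where j: "j = (a, b)" by (cases j)
      have ab: "a < b" using jK by (auto simp: K_def rat_intervals_def j)
      have "ball ((a + b) / 2) (5 * ((b - a) / 2)) = {3 * a - 2 * b <..< 3 * b - 2 * a}"
        unfolding ball_eq_greaterThanLessThan
        by (rule arg_cong2[of _ _ _ _ greaterThanLessThan]) (simp_all add: field_simps)
      then have "emeasure lborel (ball ((a + b) / 2) (5 * ((b - a) / 2))) = ennreal (5 / l * (l * (b - a)))"
        using ab l by simp
      also have "\<dots> = ennreal (5 / l) * ennreal (l * (b - a))"
        using l by (intro ennreal_mult') simp
      also have "\<dots> \<le> ennreal (5 / l) * (\<integral>\<^sup>+ t\<in>{a<..<b}. G1 t \<partial>lborel)"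
        using big jK j by (intro mult_left_mono) auto
      finally show "emeasure lborel (ball (c j) (5 * (r j))) \<le> ennreal (5 / l) * (\<integral>\<^sup>+ t\<in>{fst j<..<snd j}. G1 t \<partial>lborel)"
        by (simp add: j c_def r_def)
    qed
    also have "\<dots> = ennreal (5 / l) * (\<integral>\<^sup>+ j. emeasure (density lborel G1) {fst j<..<snd j} \<partial>count_space C)"
      by (simp add: nn_integral_cmult emeasure_density)
    also have "(\<integral>\<^sup>+ j. emeasure (density lborel G1) {fst j<..<snd j} \<partial>count_space C)
        = emeasure (density lborel G1) (\<Union>j\<in>C. {fst j<..<snd j})"
    proof (rule emeasure_UN_countable[symmetric])
      show "disjoint_family_on (\<lambda>j. {fst j<..<snd j}) C"
        unfolding disjoint_family_on_def
      proof (intro ballI impI)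
        fix i j assume "i \<in> C" "j \<in> C" "i \<noteq> j"
        then have "disjnt (cball (c i) (r i))
           (cball (c j) (r j))"
          using disj by (auto simp: pairwise_def)
        then show "{fst i<..<snd i} \<inter> {fst j<..<snd j} = {}"
          using cb[of i] cb[of j] unfolding disjnt_def by blast
      qed
    qed (use C in auto)
    also have "\<dots> \<le> X"
    proof -
      have "(\<Union>j\<in>C. {fst j<..<snd j}) \<in> sets lborel" by (simp add: open_UN)
      then show ?thesis
        unfolding X_def by (subst emeasure_density) (auto intro!: nn_integral_mono simp: indicator_def)
    qed
    finally show ?thesis by (simp add: mult_left_mono)
  qed
  then show ?thesis by (simp add: X_def G1_def)
qed

text \<open>
  The weak type estimate, multiplied by \<open>l powr (p - 1)\<close>, is integrated over all levels; Tonelli's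
  theorem then leaves the integral of \<open>l powr (p - 2)\<close> over \<open>0 < l < G t\<close>, which is finite as \<open>p > 1\<close>.
\<close>

lemma HL_maximal_strong_type:
  assumes [measurable]: "G \<in> borel_measurable borel" and p: "1 < p"
  shows "(\<integral>\<^sup>+ x. ennreal_powr (HL_maximal G x) p \<partial>lborel)
    \<le> ennreal (2 powr p * (5 * p / (p - 1))) * (\<integral>\<^sup>+ t. ennreal_powr (G t) p \<partial>lborel)"
proof -
  have [measurable]: "HL_maximal G \<in> borel_measurable borel"
  proof -
    have "(\<lambda>x. HL_maximal ((\<lambda>_. G) x) x) \<in> borel_measurable borel"
      by (rule measurable_HL_maximal) measurable
    then show ?thesis .
  qed
  define d :: real where "d = 1 / 2"
  have d: "0 < d" "2 * d = 1" by (simp_all add: d_def)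
  have half: "ennreal (2 * l) < h \<longleftrightarrow> ennreal l < ennreal d * h" if "0 < l" for l h
  proof (cases h)
    case (real r)
    have "2 * l < r \<longleftrightarrow> l < d * r" by (auto simp: d_def)
    then show ?thesis
      using real that d by (simp add: ennreal_mult'[symmetric] ennreal_less_iff)
  qed (use d in \<open>simp add: ennreal_mult_top\<close>)
  have layer: "ennreal_powr h p = ennreal (2 powr p * p) *
      (\<integral>\<^sup>+ l. ennreal (l powr (p - 1)) * indicator {l. 0 < l \<and> ennreal (2 * l) < h} l \<partial>lborel)" for h
  proof -
    have "{l. 0 < l \<and> ennreal (2 * l) < h} = {l. 0 < l \<and> ennreal l < ennreal d * h}"
      using half by auto
    then have "(\<integral>\<^sup>+ l. ennreal (l powr (p - 1)) * indicator {l. 0 < l \<and> ennreal (2 * l) < h} l \<partial>lborel)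
        = ennreal (1 / p) * (ennreal (d powr p) * ennreal_powr h p)"
      using nn_integral_powr_less[of "p - 1" "ennreal d * h"] p
      using d by (simp add: ennreal_powr_mult_left)
    then have "ennreal (2 powr p * p) * (\<integral>\<^sup>+ l. ennreal (l powr (p - 1)) * indicator {l. 0 < l \<and> ennreal (2 * l) < h} l \<partial>lborel)
        = ennreal (2 powr p * p * (1 / p * d powr p)) * ennreal_powr h p"
      using p by (simp only: ennreal_mult_mult powr_ge_zero mult_nonneg_nonneg divide_nonneg_pos zero_le_one)
    also have "2 powr p * p * (1 / p * d powr p) = 1"
      using p d by (simp add: powr_mult[symmetric])
    finally show ?thesis by simp
  qed
  let ?c = "ennreal (2 powr p * p)"
  have outer: "(\<integral>\<^sup>+ x. ennreal_powr (HL_maximal G x) p \<partial>lborel) = ?c * (\<integral>\<^sup>+ x. \<integral>\<^sup>+ l. ennreal (l powr (p - 1)) *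
      indicator {l. 0 < l \<and> ennreal (2 * l) < HL_maximal G x} l \<partial>lborel \<partial>lborel)"
    unfolding layer by (rule nn_integral_cmult) measurable
  have "(\<integral>\<^sup>+ x. \<integral>\<^sup>+ l. ennreal (l powr (p - 1)) *
      indicator {l. 0 < l \<and> ennreal (2 * l) < HL_maximal G x} l \<partial>lborel \<partial>lborel)
    = (\<integral>\<^sup>+ l. \<integral>\<^sup>+ x. ennreal (l powr (p - 1)) *
      indicator {l. 0 < l \<and> ennreal (2 * l) < HL_maximal G x} l \<partial>lborel \<partial>lborel)"
    by (rule lborel_pair.Fubini'[symmetric]) measurable
  also have "\<dots> \<le> (\<integral>\<^sup>+ l. \<integral>\<^sup>+ t. ennreal 5 * G t * (ennreal (l powr (p - 2)) *
      indicator {l. 0 < l \<and> ennreal l < G t} l) \<partial>lborel \<partial>lborel)"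
  proof (rule nn_integral_mono)
    fix l :: real
    show "(\<integral>\<^sup>+ x. ennreal (l powr (p - 1)) *
      indicator {l. 0 < l \<and> ennreal (2 * l) < HL_maximal G x} l \<partial>lborel) \<le> (\<integral>\<^sup>+ t. ennreal 5 * G t * (ennreal (l powr (p - 2)) *
      indicator {l. 0 < l \<and> ennreal l < G t} l) \<partial>lborel)"
    proof (cases "0 < l")
      case True
      have "(\<integral>\<^sup>+ x. ennreal (l powr (p - 1)) *
          indicator {l. 0 < l \<and> ennreal (2 * l) < HL_maximal G x} l \<partial>lborel)
        = (\<integral>\<^sup>+ x. ennreal (l powr (p - 1)) * indicator {x. ennreal (2 * l) < HL_maximal G x} x \<partial>lborel)"
        using True by (intro nn_integral_cong) (simp add: indicator_def)
      also have "\<dots> = ennreal (l powr (p - 1)) * emeasure lborel {x. ennreal (2 * l) < HL_maximal G x}"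
        by (rule nn_integral_cmult_indicator) measurable
      also have "\<dots> \<le> ennreal (l powr (p - 1)) * (ennreal (5 / l) * (\<integral>\<^sup>+ t. G t * indicator {t. ennreal l < G t} t \<partial>lborel))"
        using True by (intro mult_left_mono HL_maximal_weak_type) auto
      also have "\<dots> = ennreal (5 * l powr (p - 2)) * (\<integral>\<^sup>+ t. G t * indicator {t. ennreal l < G t} t \<partial>lborel)"
      proof -
        have "l powr (p - 1) * (5 / l) = 5 * l powr (p - 2)"
          using True powr_diff[of l "p - 1" 1] by simp
        then show ?thesis
          using True by (simp only: ennreal_mult_mult divide_nonneg_pos zero_le_numeral)
      qed
      also have "\<dots> = (\<integral>\<^sup>+ t. ennreal (5 * l powr (p - 2)) * (G t * indicator {t. ennreal l < G t} t) \<partial>lborel)"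
        by (rule nn_integral_cmult[symmetric]) measurable
      also have "\<dots> = (\<integral>\<^sup>+ t. ennreal 5 * G t * (ennreal (l powr (p - 2)) *
          indicator {l. 0 < l \<and> ennreal l < G t} l) \<partial>lborel)"
      proof (rule nn_integral_cong)
        fix t
        have "ennreal (5 * l powr (p - 2)) = ennreal 5 * ennreal (l powr (p - 2))"
          by (rule ennreal_mult') simp
        then show "ennreal (5 * l powr (p - 2)) * (G t * indicator {t. ennreal l < G t} t)
          = ennreal 5 * G t * (ennreal (l powr (p - 2)) * indicator {l. 0 < l \<and> ennreal l < G t} l)"
          using True by (simp only: indicator_def) (simp add: mult_ac)
      qed
      finally show ?thesis .
    qed simp
  qed
  also have "\<dots> = (\<integral>\<^sup>+ t. \<integral>\<^sup>+ l. ennreal 5 * G t * (ennreal (l powr (p - 2)) *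
      indicator {l. 0 < l \<and> ennreal l < G t} l) \<partial>lborel \<partial>lborel)"
    by (rule lborel_pair.Fubini') measurable
  also have "\<dots> \<le> (\<integral>\<^sup>+ t. ennreal (5 / (p - 1)) * ennreal_powr (G t) p \<partial>lborel)"
  proof (rule nn_integral_mono)
    fix t
    have "(\<integral>\<^sup>+ l. ennreal 5 * G t * (ennreal (l powr (p - 2)) * indicator {l. 0 < l \<and> ennreal l < G t} l) \<partial>lborel)
      = ennreal 5 * G t * (ennreal (1 / (p - 1)) * ennreal_powr (G t) (p - 1))"
      using nn_integral_powr_less[of "p - 2" "G t"] p
      by (subst nn_integral_cmult) auto
    also have "\<dots> \<le> ennreal (5 / (p - 1)) * ennreal_powr (G t) p"
    proof (cases "G t")
      case (real g)
      then have "g powr p = g * g powr (p - 1)"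
        using p by (cases "g = 0") (auto simp: powr_diff)
      then have "5 / (p - 1) * g powr p = 5 * g * (1 / (p - 1) * g powr (p - 1))"
        by simp
      then show ?thesis
        using real p
        by (simp add: ennreal_powr_ennreal ennreal_mult'[symmetric] del: ennreal_numeral times_divide_eq_left times_divide_eq_right)
    next
      case top
      then show ?thesis using p by (simp add: ennreal_powr_def ennreal_mult_top)
    qed
    finally show "(\<integral>\<^sup>+ l. ennreal 5 * G t * (ennreal (l powr (p - 2)) * indicator {l. 0 < l \<and> ennreal l < G t} l) \<partial>lborel)
      \<le> ennreal (5 / (p - 1)) * ennreal_powr (G t) p" .
  qed
  also have "\<dots> = ennreal (5 / (p - 1)) * (\<integral>\<^sup>+ t. ennreal_powr (G t) p \<partial>lborel)"
    by (rule nn_integral_cmult) measurable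
  finally have "(\<integral>\<^sup>+ x. ennreal_powr (HL_maximal G x) p \<partial>lborel)
      \<le> ?c * (ennreal (5 / (p - 1)) * (\<integral>\<^sup>+ t. ennreal_powr (G t) p \<partial>lborel))"
    unfolding outer by (rule mult_left_mono) simp
  also have "\<dots> = ?c * ennreal (5 / (p - 1)) * (\<integral>\<^sup>+ t. ennreal_powr (G t) p \<partial>lborel)"
    by (simp only: mult.assoc)
  also have "?c * ennreal (5 / (p - 1)) = ennreal (2 powr p * (5 * p / (p - 1)))"
    using p by (simp add: ennreal_mult'[symmetric])
  finally show ?thesis .
qed

section \<open>Rectangles and the iterated maximal operator\<close>

lemma nondeg_interval_bounds:
  assumes "nondeg_interval I"
  obtains a b where "a < b" "{a<..<b} \<subseteq> I" "I \<subseteq> {a..b}"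
proof -
  define a b where "a = Inf I" and "b = Sup I"
  have I: "is_interval I" "bounded I" "0 < measure lebesgue I"
    using assms by (auto simp: nondeg_interval_def)
  have ne: "I \<noteq> {}" using I(3) by auto
  have bd: "bdd_below I" "bdd_above I"
    using I(2) by (auto intro: bounded_imp_bdd_below bounded_imp_bdd_above)
  have sup: "I \<subseteq> {a..b}"
    using bd by (auto simp: a_def b_def intro: cInf_lower cSup_upper)
  have sub: "{a<..<b} \<subseteq> I"
  proof
    fix x assume "x \<in> {a<..<b}"
    then obtain u v where "u \<in> I" "u < x" "v \<in> I" "x < v"
      using ne bd by (auto simp: a_def b_def cInf_less_iff less_cSup_iff)
    then show "x \<in> I"
      using I(1) unfolding is_interval_1 by (meson less_imp_le)
  qed
  have "I \<in> lmeasurable"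
    using I by (intro measurable_convex) (auto simp: is_interval_convex)
  then have "measure lebesgue I \<le> measure lebesgue {a..b}"
    using sup by (intro measure_mono_fmeasurable) auto
  with I(3) have "a < b" by (auto split: if_splits)
  then show ?thesis using sub sup by (rule that)
qed

lemma nondeg_interval_Times:
  assumes "nondeg_interval I" "nondeg_interval J"
  shows "I \<times> J \<in> lmeasurable"
  using assms
  by (intro measurable_convex convex_Times bounded_Times)
    (auto simp: nondeg_interval_def is_interval_convex)

lemma nondeg_interval_rat_cover:
  assumes "nondeg_interval I"
  obtains a b a' b' where "a < b" "{a<..<b} \<subseteq> I" "(a', b') \<in> rat_intervals" "I \<subseteq> {a'<..<b'}"
    "b' - a' \<le> 2 * (b - a)"
proof -
  obtain a b where ab: "a < b" "{a<..<b} \<subseteq> I" "I \<subseteq> {a..b}"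
    using nondeg_interval_bounds[OF assms] .
  obtain a' where a': "a' \<in> \<rat>" "a - (b - a) / 2 < a'" "a' < a"
    using Rats_dense_in_real[of "a - (b - a) / 2" a] ab(1) by auto
  obtain b' where b': "b' \<in> \<rat>" "b < b'" "b' < b + (b - a) / 2"
    using Rats_dense_in_real[of b "b + (b - a) / 2"] ab(1) by auto
  show ?thesis
  proof (rule that[OF ab(1,2)])
    show "(a', b') \<in> rat_intervals" using a' b' ab by (auto simp: rat_intervals_def)
    show "I \<subseteq> {a'<..<b'}" using a' b' ab(3) by auto
    show "b' - a' \<le> 2 * (b - a)" using a' b' by (simp add: field_simps)
  qed
qed

lemma HL_maximal_ge:
  assumes "(a, b) \<in> rat_intervals" "x \<in> {a<..<b}"
  shows "(\<integral>\<^sup>+ t\<in>{a<..<b}. G t \<partial>lborel) \<le> ennreal (b - a) * HL_maximal G x"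
proof -
  have ab: "a < b" using assms by (auto simp: rat_intervals_def)
  have "(\<integral>\<^sup>+ t\<in>{a<..<b}. G t \<partial>lborel) / ennreal (b - a) \<le> HL_maximal G x"
    unfolding HL_maximal_def using assms(2) by (intro SUP_upper2[OF assms(1)]) simp
  then have "ennreal (b - a) * ((\<integral>\<^sup>+ t\<in>{a<..<b}. G t \<partial>lborel) / ennreal (b - a)) \<le> ennreal (b - a) * HL_maximal G x"
    by (rule mult_left_mono) simp
  then show ?thesis
    using ab by (simp add: ennreal_times_divide ennreal_mult_divide_eq mult.commute[of "ennreal (b - a)"])
qed

definition iterated_maximal :: "(real \<times> real \<Rightarrow> ennreal) \<Rightarrow> real \<times> real \<Rightarrow> ennreal" where
  "iterated_maximal g = (\<lambda>(x, y). HL_maximal (\<lambda>t. HL_maximal (\<lambda>\<tau>. g (t, \<tau>)) y) x)"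

lemma measurable_inner_maximal:
  assumes [measurable]: "g \<in> borel_measurable (lborel \<Otimes>\<^sub>M lborel)"
  shows "(\<lambda>(t, y). HL_maximal (\<lambda>\<tau>. g (t, \<tau>)) y) \<in> borel_measurable (lborel \<Otimes>\<^sub>M lborel)"
proof -
  have "(\<lambda>w. HL_maximal ((\<lambda>w \<tau>. g (fst w, \<tau>)) w) (snd w)) \<in> borel_measurable (lborel \<Otimes>\<^sub>M lborel)"
    by (rule measurable_HL_maximal) measurable
  then show ?thesis by (simp add: case_prod_beta')
qed

lemma measurable_iterated_maximal:
  assumes [measurable]: "g \<in> borel_measurable (lborel \<Otimes>\<^sub>M lborel)"
  shows "iterated_maximal g \<in> borel_measurable (lborel \<Otimes>\<^sub>M lborel)"
proof -
  have "(\<lambda>w. HL_maximal ((\<lambda>w t. HL_maximal (\<lambda>\<tau>. g (t, \<tau>)) (snd w)) w) (fst w)) \<in> borel_measurable (lborel \<Otimes>\<^sub>M lborel)"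
  proof (rule measurable_HL_maximal)
    have "(\<lambda>v. (\<lambda>(t, y). HL_maximal (\<lambda>\<tau>. g (t, \<tau>)) y) (snd v, snd (fst v)))
        \<in> borel_measurable ((lborel \<Otimes>\<^sub>M lborel) \<Otimes>\<^sub>M (lborel :: real measure))"
      by (rule measurable_compose[OF _ measurable_inner_maximal[OF assms]]) measurable
    then show "(\<lambda>(w, t). HL_maximal (\<lambda>\<tau>. g (t, \<tau>)) (snd w))
        \<in> borel_measurable ((lborel \<Otimes>\<^sub>M lborel) \<Otimes>\<^sub>M (lborel :: real measure))"
      by (simp add: case_prod_beta')
  qed measurable
  then show ?thesis by (simp add: iterated_maximal_def case_prod_beta')
qed

text \<open>
  The one-dimensional bound is used on each horizontal line and then on each vertical line.
\<close>

lemma iterated_maximal_strong_type: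
  assumes [measurable]: "g \<in> borel_measurable (lborel \<Otimes>\<^sub>M lborel)" and p: "1 < p"
  defines "C \<equiv> ennreal (2 powr p * (5 * p / (p - 1)))"
  shows "(\<integral>\<^sup>+ z. ennreal_powr (iterated_maximal g z) p \<partial>lborel) \<le> C * (C * (\<integral>\<^sup>+ z. ennreal_powr (g z) p \<partial>lborel))"
proof -
  note [measurable] = measurable_iterated_maximal[OF assms(1)] measurable_inner_maximal[OF assms(1)]
  have "(\<integral>\<^sup>+ z. ennreal_powr (iterated_maximal g z) p \<partial>lborel)
      = (\<integral>\<^sup>+ z. ennreal_powr (iterated_maximal g z) p \<partial>(lborel \<Otimes>\<^sub>M lborel))"
    by (simp add: lborel_prod)
  also have "\<dots> = (\<integral>\<^sup>+ y. \<integral>\<^sup>+ x. ennreal_powr (iterated_maximal g (x, y)) p \<partial>lborel \<partial>lborel)"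
    by (rule lborel_pair.nn_integral_snd[symmetric]) measurable
  also have "\<dots> \<le> (\<integral>\<^sup>+ y. C * (\<integral>\<^sup>+ x. ennreal_powr (HL_maximal (\<lambda>\<tau>. g (x, \<tau>)) y) p \<partial>lborel) \<partial>lborel)"
  proof (rule nn_integral_mono)
    fix y :: real
    have "(\<lambda>t. (\<lambda>(t, y). HL_maximal (\<lambda>\<tau>. g (t, \<tau>)) y) (t, y)) \<in> borel_measurable lborel"
      by measurable
    then have "(\<lambda>t. HL_maximal (\<lambda>\<tau>. g (t, \<tau>)) y) \<in> borel_measurable borel"
      by simp
    from HL_maximal_strong_type[OF this p]
    show "(\<integral>\<^sup>+ x. ennreal_powr (iterated_maximal g (x, y)) p \<partial>lborel)
        \<le> C * (\<integral>\<^sup>+ x. ennreal_powr (HL_maximal (\<lambda>\<tau>. g (x, \<tau>)) y) p \<partial>lborel)"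
      by (simp add: iterated_maximal_def C_def)
  qed
  also have "\<dots> = C * (\<integral>\<^sup>+ y. \<integral>\<^sup>+ x. ennreal_powr (HL_maximal (\<lambda>\<tau>. g (x, \<tau>)) y) p \<partial>lborel \<partial>lborel)"
    by (rule nn_integral_cmult) measurable
  also have "(\<integral>\<^sup>+ y. \<integral>\<^sup>+ x. ennreal_powr (HL_maximal (\<lambda>\<tau>. g (x, \<tau>)) y) p \<partial>lborel \<partial>lborel)
      = (\<integral>\<^sup>+ x. \<integral>\<^sup>+ y. ennreal_powr (HL_maximal (\<lambda>\<tau>. g (x, \<tau>)) y) p \<partial>lborel \<partial>lborel)"
    by (rule lborel_pair.Fubini') measurable
  finally have 1: "(\<integral>\<^sup>+ z. ennreal_powr (iterated_maximal g z) p \<partial>lborel)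
      \<le> C * (\<integral>\<^sup>+ x. \<integral>\<^sup>+ y. ennreal_powr (HL_maximal (\<lambda>\<tau>. g (x, \<tau>)) y) p \<partial>lborel \<partial>lborel)" .
  have "(\<integral>\<^sup>+ x. \<integral>\<^sup>+ y. ennreal_powr (HL_maximal (\<lambda>\<tau>. g (x, \<tau>)) y) p \<partial>lborel \<partial>lborel)
      \<le> (\<integral>\<^sup>+ x. C * (\<integral>\<^sup>+ y. ennreal_powr (g (x, y)) p \<partial>lborel) \<partial>lborel)"
  proof (rule nn_integral_mono)
    fix x :: real
    have "(\<lambda>\<tau>. g (x, \<tau>)) \<in> borel_measurable lborel"
      by measurable
    then have "(\<lambda>\<tau>. g (x, \<tau>)) \<in> borel_measurable borel"
      by simp
    from HL_maximal_strong_type[OF this p]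
    show "(\<integral>\<^sup>+ y. ennreal_powr (HL_maximal (\<lambda>\<tau>. g (x, \<tau>)) y) p \<partial>lborel) \<le> C * (\<integral>\<^sup>+ y. ennreal_powr (g (x, y)) p \<partial>lborel)"
      by (simp add: C_def)
  qed
  also have "\<dots> = C * (\<integral>\<^sup>+ x. \<integral>\<^sup>+ y. ennreal_powr (g (x, y)) p \<partial>lborel \<partial>lborel)"
    by (rule nn_integral_cmult) measurable
  also have "(\<integral>\<^sup>+ x. \<integral>\<^sup>+ y. ennreal_powr (g (x, y)) p \<partial>lborel \<partial>lborel) = (\<integral>\<^sup>+ z. ennreal_powr (g z) p \<partial>(lborel \<Otimes>\<^sub>M lborel))"
    by (rule lborel.nn_integral_fst) measurable
  finally have "(\<integral>\<^sup>+ x. \<integral>\<^sup>+ y. ennreal_powr (HL_maximal (\<lambda>\<tau>. g (x, \<tau>)) y) p \<partial>lborel \<partial>lborel)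
      \<le> C * (\<integral>\<^sup>+ z. ennreal_powr (g z) p \<partial>lborel)"
    by (simp add: lborel_prod)
  then have "C * (\<integral>\<^sup>+ x. \<integral>\<^sup>+ y. ennreal_powr (HL_maximal (\<lambda>\<tau>. g (x, \<tau>)) y) p \<partial>lborel \<partial>lborel)
      \<le> C * (C * (\<integral>\<^sup>+ z. ennreal_powr (g z) p \<partial>lborel))"
    by (rule mult_left_mono) simp
  with 1 show ?thesis by (rule order_trans)
qed

text \<open>
  The factor \<open>4\<close> is the price for enlarging both sides to rational intervals.
\<close>

lemma rectangle_integral_le_iterated_maximal:
  assumes [measurable]: "g \<in> borel_measurable (lborel \<Otimes>\<^sub>M lborel)"
    and I: "nondeg_interval I" "x \<in> I" and J: "nondeg_interval J" "y \<in> J"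
  shows "0 < measure lebesgue (I \<times> J)"
    and "(\<integral>\<^sup>+ z\<in>I \<times> J. g z \<partial>lborel) \<le> ennreal (4 * measure lebesgue (I \<times> J)) * iterated_maximal g (x, y)"
proof -
  obtain a b a' b' where ab: "a < b" "{a<..<b} \<subseteq> I" "(a', b') \<in> rat_intervals" "I \<subseteq> {a'<..<b'}"
    "b' - a' \<le> 2 * (b - a)" using nondeg_interval_rat_cover[OF I(1)] .
  obtain c d c' d' where cd: "c < d" "{c<..<d} \<subseteq> J" "(c', d') \<in> rat_intervals" "J \<subseteq> {c'<..<d'}"
    "d' - c' \<le> 2 * (d - c)" using nondeg_interval_rat_cover[OF J(1)] .
  have "measure lebesgue (box (a, c) (b, d)) \<le> measure lebesgue (I \<times> J)"
    using ab cd nondeg_interval_Times[OF I(1) J(1)]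
    by (intro measure_mono_fmeasurable) (auto simp: box_def Basis_prod_def)
  then have area: "(b - a) * (d - c) \<le> measure lebesgue (I \<times> J)"
    using ab cd by (simp add: measure_lborel_box_eq Basis_prod_def inner_Pair prod.union_disjoint mult.commute)
  with ab(1) cd(1) show "0 < measure lebesgue (I \<times> J)"
    by (smt (verit) mult_pos_pos)
  note [measurable] = measurable_inner_maximal[OF assms(1)]
  have ab': "a' < b'" and cd': "c' < d'" using ab(3) cd(3) by (auto simp: rat_intervals_def)
  have "(\<integral>\<^sup>+ z\<in>I \<times> J. g z \<partial>lborel) \<le> (\<integral>\<^sup>+ z\<in>{a'<..<b'} \<times> {c'<..<d'}. g z \<partial>lborel)"
    using ab(4) cd(4) by (intro nn_integral_mono) (auto simp: indicator_def)
  also have "\<dots> = (\<integral>\<^sup>+ z\<in>{a'<..<b'} \<times> {c'<..<d'}. g z \<partial>(lborel \<Otimes>\<^sub>M lborel))"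
    by (simp add: lborel_prod)
  also have "\<dots> = (\<integral>\<^sup>+ t. \<integral>\<^sup>+ \<tau>. g (t, \<tau>) * indicator ({a'<..<b'} \<times> {c'<..<d'}) (t, \<tau>) \<partial>lborel \<partial>lborel)"
    by (rule lborel.nn_integral_fst[symmetric]) measurable
  also have "\<dots> \<le> (\<integral>\<^sup>+ t. ennreal (d' - c') * (HL_maximal (\<lambda>\<tau>. g (t, \<tau>)) y * indicator {a'<..<b'} t) \<partial>lborel)"
  proof (rule nn_integral_mono)
    fix t :: real
    have "(\<integral>\<^sup>+ \<tau>. g (t, \<tau>) * indicator ({a'<..<b'} \<times> {c'<..<d'}) (t, \<tau>) \<partial>lborel)
       = (\<integral>\<^sup>+ \<tau>. (g (t, \<tau>) * indicator {c'<..<d'} \<tau>) * indicator {a'<..<b'} t \<partial>lborel)"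
      by (intro nn_integral_cong) (auto simp: indicator_def)
    also have "\<dots> = (\<integral>\<^sup>+ \<tau>. g (t, \<tau>) * indicator {c'<..<d'} \<tau> \<partial>lborel) * indicator {a'<..<b'} t"
      by (rule nn_integral_multc) measurable
    also have "\<dots> \<le> ennreal (d' - c') * HL_maximal (\<lambda>\<tau>. g (t, \<tau>)) y * indicator {a'<..<b'} t"
      using cd J(2) by (intro mult_right_mono HL_maximal_ge) auto
    finally show "(\<integral>\<^sup>+ \<tau>. g (t, \<tau>) * indicator ({a'<..<b'} \<times> {c'<..<d'}) (t, \<tau>) \<partial>lborel)
      \<le> ennreal (d' - c') * (HL_maximal (\<lambda>\<tau>. g (t, \<tau>)) y * indicator {a'<..<b'} t)"
      by (simp only: mult.assoc)
  qed
  also have "\<dots> = ennreal (d' - c') * (\<integral>\<^sup>+ t\<in>{a'<..<b'}. HL_maximal (\<lambda>\<tau>. g (t, \<tau>)) y \<partial>lborel)"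
    by (rule nn_integral_cmult) measurable
  also have "\<dots> \<le> ennreal (d' - c') * (ennreal (b' - a') * iterated_maximal g (x, y))"
    unfolding iterated_maximal_def prod.case using ab I(2) by (intro mult_left_mono HL_maximal_ge) auto
  also have "\<dots> = ennreal ((d' - c') * (b' - a')) * iterated_maximal g (x, y)"
    using ab' by (intro ennreal_mult_mult) simp
  also have "\<dots> \<le> ennreal (4 * measure lebesgue (I \<times> J)) * iterated_maximal g (x, y)"
  proof (intro mult_right_mono ennreal_leI)
    have "(d' - c') * (b' - a') \<le> (2 * (d - c)) * (2 * (b - a))"
      using ab cd ab' cd' by (intro mult_mono) auto
    also have "\<dots> \<le> 4 * measure lebesgue (I \<times> J)"
      using area by (simp only: mult_ac)
    finally show "(d' - c') * (b' - a') \<le> 4 * measure lebesgue (I \<times> J)" .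
  qed simp
  finally show "(\<integral>\<^sup>+ z\<in>I \<times> J. g z \<partial>lborel) \<le> ennreal (4 * measure lebesgue (I \<times> J)) * iterated_maximal g (x, y)" .
qed

section \<open>Boundedness for a constant exponent\<close>

text \<open>
  A form of Young's inequality that holds because either \<open>u \<le> s\<close> or \<open>u = u powr k * u powr (1 - k)\<close> with
  \<open>u powr (1 - k) \<le> s powr (1 - k)\<close>. Integrated, and with \<open>s\<close> chosen well, it gives Hoelder's inequality
  up to the factor \<open>2\<close>.
\<close>

lemma ennreal_young:
  assumes "0 < s" "1 \<le> k"
  shows "u \<le> ennreal s + ennreal (s powr (1 - k)) * ennreal_powr u k"
proof (cases u)
  case (real r)
  have "r \<le> s + s powr (1 - k) * r powr k"
  proof (cases "r \<le> s")
    case False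
    then have "r = r powr k * r powr (1 - k)"
      using assms by (simp add: powr_add[symmetric])
    also have "\<dots> \<le> r powr k * s powr (1 - k)"
      using False assms by (intro mult_left_mono powr_mono2') auto
    finally show ?thesis using assms by (simp add: mult.commute)
  qed (simp add: add_increasing2)
  then show ?thesis
    using real assms
    by (simp add: ennreal_powr_ennreal ennreal_mult'[symmetric] ennreal_plus[symmetric] del: ennreal_plus)
qed (use assms in \<open>simp add: ennreal_powr_def ennreal_mult_top\<close>)

lemma set_nn_integral_le_of_modular:
  fixes g :: "real \<times> real \<Rightarrow> ennreal"
  assumes [measurable]: "g \<in> borel_measurable borel" and k: "1 < k"
    and mod: "(\<integral>\<^sup>+ z. ennreal_powr (g z) k \<partial>lborel) \<le> 1"
    and R: "R \<in> lmeasurable" "0 < measure lebesgue R"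
  shows "(\<integral>\<^sup>+ z\<in>R. g z \<partial>lborel) \<le> ennreal (2 * measure lebesgue R powr (1 - 1 / k))"
proof -
  define r where "r = measure lebesgue R"
  \<comment> \<open>the value of \<open>s\<close> at which both terms of \<open>ennreal_young\<close> are equal after integration over \<open>R\<close> if the modular is \<open>1\<close>\<close>
  define s where "s = r powr (- (1 / k))"
  have r: "0 < r" and s: "0 < s" using R by (auto simp: r_def s_def)
  have [measurable]: "R \<in> sets lebesgue" using R by auto
  have [measurable]: "g \<in> borel_measurable lebesgue"
    by (rule measurable_completion) simp
  have "(\<integral>\<^sup>+ z\<in>R. g z \<partial>lborel) = (\<integral>\<^sup>+ z\<in>R. g z \<partial>lebesgue)"
    by (simp add: nn_integral_completion)
  also have "\<dots> \<le> (\<integral>\<^sup>+ z. ennreal s * indicator R z + ennreal (s powr (1 - k)) * ennreal_powr (g z) k \<partial>lebesgue)"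
    using ennreal_young[OF s, of k] k by (intro nn_integral_mono) (auto simp: indicator_def)
  also have "\<dots> = (\<integral>\<^sup>+ z. ennreal s * indicator R z \<partial>lebesgue) + (\<integral>\<^sup>+ z. ennreal (s powr (1 - k)) * ennreal_powr (g z) k \<partial>lebesgue)"
    by (rule nn_integral_add) measurable
  also have "(\<integral>\<^sup>+ z. ennreal s * indicator R z \<partial>lebesgue) = ennreal s * ennreal r"
    using R by (simp add: nn_integral_cmult_indicator emeasure_eq_measure2 r_def)
  also have "(\<integral>\<^sup>+ z. ennreal (s powr (1 - k)) * ennreal_powr (g z) k \<partial>lebesgue)
      = ennreal (s powr (1 - k)) * (\<integral>\<^sup>+ z. ennreal_powr (g z) k \<partial>lebesgue)"
    by (rule nn_integral_cmult) measurable
  also have "ennreal s * ennreal r + \<dots> \<le> ennreal s * ennreal r + ennreal (s powr (1 - k)) * 1"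
    using mod by (intro add_left_mono mult_left_mono) (auto simp: nn_integral_completion)
  also have "\<dots> = ennreal (s * r + s powr (1 - k))"
    using s r by (simp add: ennreal_mult'[symmetric] ennreal_plus[symmetric] del: ennreal_plus)
  also have "s * r = r powr (1 - 1 / k)"
    using r by (simp add: s_def powr_diff powr_minus field_simps)
  also have "s powr (1 - k) = r powr (1 - 1 / k)"
  proof -
    have "- (1 / k) * (1 - k) = 1 - 1 / k" using k by (simp add: field_simps)
    then show ?thesis by (simp add: s_def powr_powr)
  qed
  finally show ?thesis by (simp add: r_def)
qed

text \<open>
  The bound on \<open>A\<close> is equivalent to \<open>r \<le> (A / 2) powr (-k)\<close>, so the factor \<open>r powr \<alpha>\<close> can be traded for a
  negative power of \<open>A\<close>.
\<close>

lemma hedberg_real: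
  fixes r A \<alpha> k :: real
  assumes "0 < r" "0 < k" "0 \<le> \<alpha>" "\<alpha> * k \<le> 1" "0 \<le> A" and A: "A \<le> 2 * r powr (- (1 / k))"
  shows "r powr \<alpha> * A \<le> 2 * A powr (1 - \<alpha> * k)"
proof (cases "A = 0")
  case False
  define B where "B = A / 2"
  have B: "0 < B" "B \<le> r powr (- (1 / k))" using False assms by (auto simp: B_def)
  have "r powr \<alpha> = (r powr (- (1 / k))) powr (- (\<alpha> * k))"
    using assms by (simp add: powr_powr)
  also have "\<dots> \<le> B powr (- (\<alpha> * k))"
    using assms B by (intro powr_mono2') auto
  finally have "r powr \<alpha> * A \<le> B powr (- (\<alpha> * k)) * (2 * B)"
    using B by (intro mult_mono) (auto simp: B_def)
  also have "\<dots> = 2 * B powr (1 - \<alpha> * k)"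
    using B by (simp add: powr_diff powr_minus field_simps)
  also have "\<dots> \<le> 2 * A powr (1 - \<alpha> * k)"
    using assms B by (intro mult_left_mono powr_mono2) (auto simp: B_def)
  finally show ?thesis .
qed simp

lemma strong_frac_maximal_le_iterated_maximal:
  assumes [measurable]: "f \<in> borel_measurable borel" and k: "1 < k" and a: "0 \<le> \<alpha>" "\<alpha> * k < 1"
    and mod: "(\<integral>\<^sup>+ z. ennreal_powr (ennreal \<bar>f z\<bar>) k \<partial>lborel) \<le> 1"
  shows "strong_frac_maximal \<alpha> f z
    \<le> ennreal 2 * ennreal_powr (ennreal 4 * iterated_maximal (\<lambda>z. ennreal \<bar>f z\<bar>) z) (1 - \<alpha> * k)"
proof -
  obtain x y where z: "z = (x, y)" by (cases z)
  let ?g = "\<lambda>z. ennreal \<bar>f z\<bar>"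
  have g: "?g \<in> borel_measurable (lborel \<Otimes>\<^sub>M lborel)"
    by (simp add: lborel_prod)
  show ?thesis
    unfolding z strong_frac_maximal_def prod.case
  proof (rule Sup_least, safe)
    fix I J assume I: "nondeg_interval I" "x \<in> I" and J: "nondeg_interval J" "y \<in> J"
    define r where "r = measure lebesgue (I \<times> J)"
    define N where "N = iterated_maximal ?g (x, y)"
    have r: "0 < r" and le: "(\<integral>\<^sup>+ z\<in>I \<times> J. ?g z \<partial>lborel) \<le> ennreal (4 * r) * N"
      using rectangle_integral_le_iterated_maximal[OF g I J] by (auto simp: r_def N_def)
    have le2: "(\<integral>\<^sup>+ z\<in>I \<times> J. ?g z \<partial>lborel) \<le> ennreal (2 * r powr (1 - 1 / k))"
      using set_nn_integral_le_of_modular[OF _ k mod nondeg_interval_Times[OF I(1) J(1)]] r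
      by (simp add: r_def)
    then have "(\<integral>\<^sup>+ z\<in>I \<times> J. ?g z \<partial>lborel) < top"
      by (rule le_less_trans) simp
    then obtain S where S: "(\<integral>\<^sup>+ z\<in>I \<times> J. ?g z \<partial>lborel) = ennreal S" "0 \<le> S"
      by (cases "\<integral>\<^sup>+ z\<in>I \<times> J. ?g z \<partial>lborel") auto
    define A where "A = S / r"
    have "S \<le> 2 * r powr (1 - 1 / k)" using le2 S by simp
    then have "A \<le> 2 * (r powr (1 - 1 / k) / r)"
      using r by (simp add: A_def field_simps)
    also have "r powr (1 - 1 / k) / r = r powr (- (1 / k))"
      using r by (simp add: powr_diff powr_minus field_simps)
    finally have "r powr \<alpha> * A \<le> 2 * A powr (1 - \<alpha> * k)"
      using r k a S by (intro hedberg_real) (auto simp: A_def)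
    then have "r powr (\<alpha> - 1) * S \<le> 2 * A powr (1 - \<alpha> * k)"
      using r by (simp add: A_def powr_diff)
    then have "ennreal (r powr (\<alpha> - 1)) * ennreal S \<le> ennreal 2 * ennreal_powr (ennreal A) (1 - \<alpha> * k)"
      using S r by (simp add: A_def ennreal_powr_ennreal ennreal_mult'[symmetric] del: ennreal_numeral)
    also have "\<dots> \<le> ennreal 2 * ennreal_powr (ennreal 4 * N) (1 - \<alpha> * k)"
    proof (intro mult_left_mono ennreal_powr_mono)
      have "ennreal A = ennreal (1 / r) * ennreal S"
        using r S by (simp add: A_def ennreal_mult'[symmetric])
      also have "\<dots> \<le> ennreal (1 / r) * (ennreal (4 * r) * N)"
        using le S by (intro mult_left_mono) auto
      also have "\<dots> = ennreal 4 * N"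
        using r by (subst ennreal_mult_mult) auto
      finally show "ennreal A \<le> ennreal 4 * N" .
    qed (use a in auto)
    finally show "ennreal (measure lebesgue (I \<times> J) powr (\<alpha> - 1)) * (\<integral>\<^sup>+ z\<in>I \<times> J. ennreal \<bar>f z\<bar> \<partial>lebesgue)
        \<le> ennreal 2 * ennreal_powr (ennreal 4 * iterated_maximal (\<lambda>z. ennreal \<bar>f z\<bar>) (x, y)) (1 - \<alpha> * k)"
      using S by (simp add: nn_integral_completion r_def N_def)
  qed
qed

lemma strong_frac_maximal_cong_AE:
  assumes "AE z in lebesgue. f z = h z"
  shows "strong_frac_maximal \<alpha> f = strong_frac_maximal \<alpha> h"
proof -
  have "(\<integral>\<^sup>+ z\<in>R. ennreal \<bar>f z\<bar> \<partial>lebesgue) = (\<integral>\<^sup>+ z\<in>R. ennreal \<bar>h z\<bar> \<partial>lebesgue)" for R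
    using assms by (intro nn_integral_cong_AE) auto
  then show ?thesis by (simp add: strong_frac_maximal_def)
qed

lemma strong_frac_maximal_le_cmult:
  assumes [measurable]: "f \<in> borel_measurable lebesgue" and t: "0 < t"
  shows "strong_frac_maximal \<alpha> f z \<le> ennreal t * strong_frac_maximal \<alpha> (\<lambda>z. f z / t) z"
proof -
  obtain x y where z: "z = (x, y)" by (cases z)
  show ?thesis
    unfolding z strong_frac_maximal_def prod.case
  proof (rule Sup_least, clarify)
    fix I J assume I: "nondeg_interval I" "x \<in> I" and J: "nondeg_interval J" "y \<in> J"
    let ?w = "ennreal (measure lebesgue (I \<times> J) powr (\<alpha> - 1))"
    have [measurable]: "I \<times> J \<in> sets lebesgue"
      using nondeg_interval_Times[OF I(1) J(1)] by auto
    have "(\<integral>\<^sup>+ z\<in>I \<times> J. ennreal \<bar>f z\<bar> \<partial>lebesgue) = (\<integral>\<^sup>+ z. ennreal t * (ennreal \<bar>f z / t\<bar> * indicator (I \<times> J) z) \<partial>lebesgue)"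
      using t by (intro nn_integral_cong) (simp add: ennreal_mult_mult mult.assoc[symmetric] ennreal_mult'[symmetric] indicator_def)
    also have "\<dots> = ennreal t * (\<integral>\<^sup>+ z\<in>I \<times> J. ennreal \<bar>f z / t\<bar> \<partial>lebesgue)"
      by (rule nn_integral_cmult) measurable
    finally have "?w * (\<integral>\<^sup>+ z\<in>I \<times> J. ennreal \<bar>f z\<bar> \<partial>lebesgue)
        = ennreal t * (?w * (\<integral>\<^sup>+ z\<in>I \<times> J. ennreal \<bar>f z / t\<bar> \<partial>lebesgue))"
      by (simp only: mult.left_commute)
    also have "\<dots> \<le> ennreal t * Sup {ennreal (measure lebesgue (I \<times> J) powr (\<alpha> - 1)) *
            (\<integral>\<^sup>+ z \<in> I \<times> J. ennreal \<bar>f z / t\<bar> \<partial>lebesgue) | I J.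
          nondeg_interval I \<and> nondeg_interval J \<and> x \<in> I \<and> y \<in> J}"
      using I J by (intro mult_left_mono Sup_upper) (blast, simp)
    finally show "?w * (\<integral>\<^sup>+ z\<in>I \<times> J. ennreal \<bar>f z\<bar> \<partial>lebesgue) \<le> \<dots>" .
  qed
qed

text \<open>
  The integral is monotone even on functions that are not measurable, so it suffices to integrate the
  Borel measurable majorant from \<open>strong_frac_maximal_le_iterated_maximal\<close>. That majorant requires \<open>f\<close>
  to be Borel measurable, hence the passage to a Borel version \<open>h\<close>.
\<close>

lemma strong_frac_maximal_modular_bound:
  fixes k \<alpha> :: real
  assumes k: "1 < k" and a: "0 \<le> \<alpha>" "\<alpha> * k < 1"
  obtains c where "0 < c" "\<And>f. \<lbrakk>f \<in> borel_measurable lebesgue; (\<integral>\<^sup>+ z. ennreal_powr (ennreal \<bar>f z\<bar>) k \<partial>lebesgue) \<le> 1\<rbrakk>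
    \<Longrightarrow> (\<integral>\<^sup>+ z. ennreal_powr (ennreal (1 / c) * strong_frac_maximal \<alpha> f z) (k / (1 - \<alpha> * k)) \<partial>lebesgue) \<le> 1"
proof -
  define Q where "Q = k / (1 - \<alpha> * k)"
  define D where "D = 2 powr k * (5 * k / (k - 1))"
  define W where "W = 4 powr k * D * D"
  \<comment> \<open>chosen so that \<open>(2 / c) powr Q = 1 / W\<close>, where \<open>W\<close> collects the constants of the pointwise bound
    and of the iterated maximal operator\<close>
  define c where "c = 2 * W powr (1 / Q)"
  have Q: "0 < Q" "(1 - \<alpha> * k) * Q = k" using k a by (auto simp: Q_def)
  have D: "0 < D" using k by (simp add: D_def)
  then have W: "0 < W" by (simp add: W_def)
  then have c: "0 < c" by (simp add: c_def)
  have "(2 / c) powr Q = (W powr (- (1 / Q))) powr Q"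
    by (simp add: c_def powr_minus_divide)
  also have "\<dots> = W powr (- 1)" unfolding powr_powr using Q by simp
  also have "\<dots> = 1 / W" using W by (simp add: powr_minus_divide)
  finally have cW: "(2 / c) powr Q = 1 / W" .
  have "(\<integral>\<^sup>+ z. ennreal_powr (ennreal (1 / c) * strong_frac_maximal \<alpha> f z) Q \<partial>lebesgue) \<le> 1"
    if f: "f \<in> borel_measurable lebesgue" "(\<integral>\<^sup>+ z. ennreal_powr (ennreal \<bar>f z\<bar>) k \<partial>lebesgue) \<le> 1" for f
  proof -
    obtain h where h: "h \<in> borel_measurable lborel" "AE z in lborel. f z = h z"
      using completion_ex_borel_measurable_real[OF f(1)] by blast
    have [measurable]: "h \<in> borel_measurable borel" using h(1) by simp
    define N where "N = iterated_maximal (\<lambda>z. ennreal \<bar>h z\<bar>)"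
    have eq: "strong_frac_maximal \<alpha> f = strong_frac_maximal \<alpha> h"
      by (rule strong_frac_maximal_cong_AE) (use h(2) in \<open>rule AE_completion\<close>)
    have g: "(\<lambda>z. ennreal \<bar>h z\<bar>) \<in> borel_measurable (lborel \<Otimes>\<^sub>M lborel)"
      by (simp add: lborel_prod)
    have "(\<integral>\<^sup>+ z. ennreal_powr (ennreal \<bar>h z\<bar>) k \<partial>lborel) = (\<integral>\<^sup>+ z. ennreal_powr (ennreal \<bar>f z\<bar>) k \<partial>lborel)"
      using h(2) by (intro nn_integral_cong_AE) auto
    then have mod: "(\<integral>\<^sup>+ z. ennreal_powr (ennreal \<bar>h z\<bar>) k \<partial>lborel) \<le> 1"
      using f(2) by (simp add: nn_integral_completion)
    have [measurable]: "N \<in> borel_measurable borel"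
      using measurable_iterated_maximal[OF g] by (simp add: N_def lborel_prod)
    have pt: "ennreal_powr (ennreal (1 / c) * strong_frac_maximal \<alpha> h z) Q
        \<le> ennreal (1 / W * 4 powr k) * ennreal_powr (N z) k" for z
    proof -
      have "ennreal (1 / c) * strong_frac_maximal \<alpha> h z
          \<le> ennreal (1 / c) * (ennreal 2 * ennreal_powr (ennreal 4 * N z) (1 - \<alpha> * k))"
        unfolding N_def by (intro mult_left_mono strong_frac_maximal_le_iterated_maximal k a mod) auto
      also have "\<dots> = ennreal (2 / c) * ennreal_powr (ennreal 4 * N z) (1 - \<alpha> * k)"
        by (subst ennreal_mult_mult) auto
      finally have "ennreal_powr (ennreal (1 / c) * strong_frac_maximal \<alpha> h z) Q
          \<le> ennreal_powr (ennreal (2 / c) * ennreal_powr (ennreal 4 * N z) (1 - \<alpha> * k)) Q"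
        using Q by (intro ennreal_powr_mono) auto
      also have "\<dots> = ennreal (1 / W) * ennreal_powr (ennreal 4 * N z) k"
        using c Q cW by (subst ennreal_powr_mult_left) (auto simp: ennreal_powr_powr)
      also have "\<dots> = ennreal (1 / W) * (ennreal (4 powr k) * ennreal_powr (N z) k)"
        by (subst ennreal_powr_mult_left) auto
      also have "\<dots> = ennreal (1 / W * 4 powr k) * ennreal_powr (N z) k"
        by (rule ennreal_mult_mult) simp
      finally show ?thesis .
    qed
    have "(\<integral>\<^sup>+ z. ennreal_powr (ennreal (1 / c) * strong_frac_maximal \<alpha> f z) Q \<partial>lebesgue)
        \<le> (\<integral>\<^sup>+ z. ennreal (1 / W * 4 powr k) * ennreal_powr (N z) k \<partial>lborel)"
      unfolding eq nn_integral_completion by (intro nn_integral_mono pt)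
    also have "\<dots> = ennreal (1 / W * 4 powr k) * (\<integral>\<^sup>+ z. ennreal_powr (N z) k \<partial>lborel)"
      by (rule nn_integral_cmult) measurable
    also have "\<dots> \<le> ennreal (1 / W * 4 powr k) * (ennreal D * (ennreal D * (\<integral>\<^sup>+ z. ennreal_powr (ennreal \<bar>h z\<bar>) k \<partial>lborel)))"
      unfolding N_def D_def by (intro mult_left_mono iterated_maximal_strong_type g k) simp
    also have "\<dots> = ennreal (1 / W * 4 powr k * D * D) * (\<integral>\<^sup>+ z. ennreal_powr (ennreal \<bar>h z\<bar>) k \<partial>lborel)"
      using D by (simp only: ennreal_mult_mult less_imp_le mult_nonneg_nonneg mult.assoc)
    also have "1 / W * 4 powr k * D * D = 1"
      using D by (simp add: W_def)
    finally show ?thesis using mod by simp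
  qed
  with c show ?thesis unfolding Q_def by (rule that)
qed

lemma strong_frac_maximal_bounded_const:
  fixes k \<alpha> :: real
  assumes k: "1 < k" and a: "0 \<le> \<alpha>" "\<alpha> * k < 1"
    and p: "AE z in lebesgue. p z = k" and q: "AE z in lebesgue. q z = k / (1 - \<alpha> * k)"
  shows "strong_frac_maximal_bounded \<alpha> p q"
proof -
  obtain c where c: "0 < c" and bd: "\<And>f. \<lbrakk>f \<in> borel_measurable lebesgue; (\<integral>\<^sup>+ z. ennreal_powr (ennreal \<bar>f z\<bar>) k \<partial>lebesgue) \<le> 1\<rbrakk>
    \<Longrightarrow> (\<integral>\<^sup>+ z. ennreal_powr (ennreal (1 / c) * strong_frac_maximal \<alpha> f z) (k / (1 - \<alpha> * k)) \<partial>lebesgue) \<le> 1"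
    by (rule strong_frac_maximal_modular_bound[OF assms(1-3)]) blast
  have "var_lux_norm q (strong_frac_maximal \<alpha> f) \<le> ennreal c * var_norm p f" if "f \<in> var_Lp p" for f
  proof -
    have [measurable]: "f \<in> borel_measurable lebesgue" using that by (simp add: var_Lp_def)
    let ?L = "var_lux_norm q (strong_frac_maximal \<alpha> f)"
    have "ennreal (1 / c) * ?L \<le> var_norm p f"
      unfolding var_norm_def var_lux_norm_def[of p]
    proof (rule Inf_greatest, clarify)
      fix t :: real assume t: "0 < t" "(\<integral>\<^sup>+ z. ennreal_powr (ennreal \<bar>f z\<bar> / ennreal t) (p z) \<partial>lebesgue) \<le> 1"
      have "(\<integral>\<^sup>+ z. ennreal_powr (ennreal \<bar>f z / t\<bar>) k \<partial>lebesgue)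
          = (\<integral>\<^sup>+ z. ennreal_powr (ennreal \<bar>f z\<bar> / ennreal t) (p z) \<partial>lebesgue)"
        using p t by (intro nn_integral_cong_AE) (auto simp: divide_ennreal)
      with t have "(\<integral>\<^sup>+ z. ennreal_powr (ennreal \<bar>f z / t\<bar>) k \<partial>lebesgue) \<le> 1" by simp
      then have 1: "(\<integral>\<^sup>+ z. ennreal_powr (ennreal (1 / c) * strong_frac_maximal \<alpha> (\<lambda>z. f z / t) z) (k / (1 - \<alpha> * k)) \<partial>lebesgue) \<le> 1"
        by (intro bd) measurable
      have "(\<integral>\<^sup>+ z. ennreal_powr (strong_frac_maximal \<alpha> f z / ennreal (c * t)) (q z) \<partial>lebesgue)
        \<le> (\<integral>\<^sup>+ z. ennreal_powr (ennreal (1 / c) * strong_frac_maximal \<alpha> (\<lambda>z. f z / t) z) (k / (1 - \<alpha> * k)) \<partial>lebesgue)"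
      proof (rule nn_integral_mono_AE)
        show "AE z in lebesgue. ennreal_powr (strong_frac_maximal \<alpha> f z / ennreal (c * t)) (q z)
          \<le> ennreal_powr (ennreal (1 / c) * strong_frac_maximal \<alpha> (\<lambda>z. f z / t) z) (k / (1 - \<alpha> * k))"
          using q
        proof eventually_elim
          case (elim z)
          have "strong_frac_maximal \<alpha> f z / ennreal (c * t) = ennreal (1 / (c * t)) * strong_frac_maximal \<alpha> f z"
            using c t by (simp add: divide_ennreal_def inverse_ennreal inverse_eq_divide mult.commute)
          also have "\<dots> \<le> ennreal (1 / (c * t)) * (ennreal t * strong_frac_maximal \<alpha> (\<lambda>z. f z / t) z)"
            using t by (intro mult_left_mono strong_frac_maximal_le_cmult) auto
          also have "\<dots> = ennreal (1 / c) * strong_frac_maximal \<alpha> (\<lambda>z. f z / t) z"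
            using t by (subst ennreal_mult_mult) auto
          finally show ?case
            using elim k a by (auto intro!: ennreal_powr_mono)
        qed
      qed
      with 1 have "?L \<le> ennreal (c * t)"
        unfolding var_lux_norm_def using c t by (intro Inf_lower) auto
      then have "ennreal (1 / c) * ?L \<le> ennreal (1 / c) * ennreal (c * t)"
        by (rule mult_left_mono) simp
      also have "\<dots> = ennreal t"
        using c t by (simp add: ennreal_mult'[symmetric])
      finally show "ennreal (1 / c) * ?L \<le> ennreal t" .
    qed
    then have "ennreal c * (ennreal (1 / c) * ?L) \<le> ennreal c * var_norm p f"
      by (rule mult_left_mono) simp
    then show ?thesis
      using c by (simp add: ennreal_mult_mult)
  qed
  with c show ?thesis unfolding strong_frac_maximal_bounded_def by blast
qed

section \<open>Thin rectangles that meet two sets\<close>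

lemma measure_rectangle:
  fixes a b c d :: real
  assumes "a \<le> b" "c \<le> d"
  shows "measure lebesgue ({a..b} \<times> {c..d}) = (b - a) * (d - c)"
proof -
  have "measure lebesgue (cbox (a, c) (b, d)) = (b - a) * (d - c)"
    using assms by (simp add: content_Pair)
  then show ?thesis by (simp only: cbox_Pair_eq box_real)
qed

lemma lmeasurable_Int_sets:
  assumes "E \<in> sets lebesgue" "R \<in> lmeasurable"
  shows "E \<inter> R \<in> lmeasurable"
  using fmeasurable_Int_fmeasurable[OF assms(2,1)] by (simp add: Int_commute)

lemma lmeasurable_rectangle [simp]: "{a..b} \<times> {c..d} \<in> lmeasurable" for a b c d :: real
  using lmeasurable_cbox[of "(a, c)" "(b, d)"] by (simp add: cbox_Pair_eq)

text \<open>
  A weak form of Lebesgue's density theorem. A bounded part \<open>S\<close> of \<open>E\<close> is covered by nonoverlapping boxes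
  of total volume at most \<open>5/4\<close> of its measure. If each box met \<open>S\<close> in at most three
  quarters of its volume, then \<open>S\<close> would have at most \<open>15/16\<close> of its own measure.
\<close>

lemma density_box:
  fixes E :: "'a :: euclidean_space set"
  assumes "E \<in> sets lebesgue" "\<not> negligible E"
  obtains u v where "0 < measure lebesgue (cbox u v)"
    "3 / 4 * measure lebesgue (cbox u v) \<le> measure lebesgue (E \<inter> cbox u v)"
proof -
  obtain a b where ab: "\<not> negligible (E \<inter> cbox a b)"
    using assms(2) negligible_on_intervals[of E] by blast
  define S where "S = E \<inter> cbox a b"
  have S: "S \<in> lmeasurable" "S \<subseteq> cbox a b"
    using assms(1) by (auto simp: S_def intro!: lmeasurable_Int_sets)
  define m where "m = measure lebesgue S"
  have m: "0 < m"
    using ab S by (simp add: m_def S_def negligible_iff_measure zero_less_measure_iff)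
  obtain D where D: "countable D" "\<And>K. K \<in> D \<Longrightarrow> K \<subseteq> cbox a b \<and> K \<noteq> {} \<and> (\<exists>c d. K = cbox c d)"
      "pairwise (\<lambda>A B. interior A \<inter> interior B = {}) D"
      and SD: "S \<subseteq> \<Union>D" "\<Union>D \<in> lmeasurable" "measure lebesgue (\<Union>D) \<le> measure lebesgue S + m / 4"
  proof (rule measurable_outer_intervals_bounded[OF S, of "m / 4"])
    show "0 < m / 4" using m by simp
  qed (rule that; assumption)
  have "\<exists>K\<in>D. 3 / 4 * measure lebesgue K < measure lebesgue (S \<inter> K)"
  proof (rule ccontr)
    assume "\<not> ?thesis"
    then have small: "measure lebesgue (S \<inter> K) \<le> 3 / 4 * measure lebesgue K" if "K \<in> D" for K
      using that by (auto simp: not_less)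
    have Kl: "K \<in> lmeasurable" if "K \<in> D" for K using D(2)[OF that] by auto
    have "ennreal m = emeasure lebesgue (\<Union>K\<in>D. S \<inter> K)"
    proof -
      have "(\<Union>K\<in>D. S \<inter> K) = S" using SD(1) by auto
      then show ?thesis using S(1) by (simp add: emeasure_eq_measure2 m_def)
    qed
    also have "\<dots> \<le> (\<integral>\<^sup>+ K. emeasure lebesgue (S \<inter> K) \<partial>count_space D)"
      using S(1) Kl D(1) by (intro emeasure_UN_countable_le) auto
    also have "\<dots> \<le> (\<integral>\<^sup>+ K. ennreal (3 / 4) * emeasure lebesgue (interior K) \<partial>count_space D)"
    proof (rule nn_integral_mono)
      fix K assume "K \<in> space (count_space D)"
      then have K: "K \<in> D" by simp
      then obtain c d where cd: "K = cbox c d" using D(2) by blast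
      have "emeasure lebesgue (S \<inter> K) = ennreal (measure lebesgue (S \<inter> K))"
        using S(1) Kl[OF K] by (intro emeasure_eq_measure2 fmeasurable.Int)
      also have "\<dots> \<le> ennreal (3 / 4 * measure lebesgue K)"
        using small[OF K] by (rule ennreal_leI)
      also have "\<dots> = ennreal (3 / 4) * emeasure lebesgue K"
        using Kl[OF K] by (simp only: emeasure_eq_measure2) (rule ennreal_mult, auto)
      also have "emeasure lebesgue K = emeasure lebesgue (interior K)"
        unfolding cd interior_cbox by (simp add: emeasure_lborel_box_eq emeasure_lborel_cbox_eq)
      finally show "emeasure lebesgue (S \<inter> K) \<le> ennreal (3 / 4) * emeasure lebesgue (interior K)" .
    qed
    also have "\<dots> = ennreal (3 / 4) * (\<integral>\<^sup>+ K. emeasure lebesgue (interior K) \<partial>count_space D)"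
      by (rule nn_integral_cmult) simp
    also have "(\<integral>\<^sup>+ K. emeasure lebesgue (interior K) \<partial>count_space D) = emeasure lebesgue (\<Union>K\<in>D. interior K)"
      using D by (intro emeasure_UN_countable[symmetric]) (auto simp: disjoint_family_on_def pairwise_def)
    also have "\<dots> \<le> emeasure lebesgue (\<Union>D)"
      using SD(2) interior_subset by (intro emeasure_mono) auto
    also have "\<dots> = ennreal (measure lebesgue (\<Union>D))"
      using SD(2) by (rule emeasure_eq_measure2)
    also have "\<dots> \<le> ennreal (m + m / 4)"
      using SD(3) by (intro ennreal_leI) (simp add: m_def)
    finally have "ennreal m \<le> ennreal (3 / 4) * ennreal (m + m / 4)"
      by (simp add: mult_left_mono)
    also have "\<dots> = ennreal (3 / 4 * (m + m / 4))"
      using m by (intro ennreal_mult[symmetric]) auto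
    finally have "m \<le> 3 / 4 * (m + m / 4)" using m by (subst (asm) ennreal_le_iff) auto
    then show False using m by simp
  qed
  then obtain K where K: "K \<in> D" "3 / 4 * measure lebesgue K < measure lebesgue (S \<inter> K)" by blast
  obtain u v where uv: "K = cbox u v" using D(2)[OF K(1)] by blast
  have "measure lebesgue (S \<inter> K) \<le> measure lebesgue K"
    using S(1) uv by (intro measure_mono_fmeasurable) auto
  then have pos: "0 < measure lebesgue K" using K(2) by linarith
  have "measure lebesgue (S \<inter> K) \<le> measure lebesgue (E \<inter> K)"
    using S(1) uv assms(1) by (intro measure_mono_fmeasurable) (auto simp: S_def intro: lmeasurable_Int_sets)
  with K(2) pos show ?thesis by (intro that[of u v]) (auto simp: uv)
qed

lemma density_rectangle:
  fixes E :: "(real \<times> real) set"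
  assumes "E \<in> sets lebesgue" "\<not> negligible E"
  obtains a b c d where "a < b" "c < d"
    "3 / 4 * ((b - a) * (d - c)) \<le> measure lebesgue (E \<inter> {a..b} \<times> {c..d})"
proof -
  obtain u v where uv: "0 < measure lebesgue (cbox u v)"
    "3 / 4 * measure lebesgue (cbox u v) \<le> measure lebesgue (E \<inter> cbox u v)"
    using density_box[OF assms] .
  obtain a c b d where eq: "u = (a, c)" "v = (b, d)" by (cases u, cases v)
  have "a < b" "c < d"
    using uv(1) by (auto simp: eq content_Pair zero_less_mult_iff split: if_splits)
  with uv(2) show ?thesis
    by (intro that[of a b c d]) (simp_all add: eq cbox_Pair_eq measure_rectangle)
qed

lemma bisection_preserves_density:
  fixes \<phi> :: "real \<Rightarrow> real \<Rightarrow> real"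
  assumes add: "\<And>a m b. \<lbrakk>a \<le> m; m \<le> b\<rbrakk> \<Longrightarrow> \<phi> a b = \<phi> a m + \<phi> m b"
    and "a < b" "\<kappa> * (b - a) \<le> \<phi> a b"
  shows "\<exists>a' b'. a' < b' \<and> b' - a' = (b - a) / 2 ^ n \<and> \<kappa> * (b' - a') \<le> \<phi> a' b'"
proof (induction n)
  case 0
  then show ?case using assms by auto
next
  case (Suc n)
  then obtain a' b' where ab: "a' < b'" "b' - a' = (b - a) / 2 ^ n" "\<kappa> * (b' - a') \<le> \<phi> a' b'"
    by blast
  define m where "m = (a' + b') / 2"
  have m: "a' < m" "m < b'" "m - a' = (b' - a') / 2" "b' - m = (b' - a') / 2"
    using ab(1) by (auto simp: m_def field_simps)
  have m': "m - a' = (b - a) / 2 ^ Suc n" "b' - m = (b - a) / 2 ^ Suc n"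
    using m ab(2) by simp_all
  have "\<kappa> * (m - a') + \<kappa> * (b' - m) \<le> \<phi> a' m + \<phi> m b'"
    using ab(3) add[of a' m b'] m(1,2) by (simp add: algebra_simps)
  then consider "\<kappa> * (m - a') \<le> \<phi> a' m" | "\<kappa> * (b' - m) \<le> \<phi> m b'" by linarith
  then show ?case
  proof cases
    case 1
    then show ?thesis using m(1) m'(1) by blast
  next
    case 2
    then show ?thesis using m(2) m'(2) by blast
  qed
qed

lemma measure_rectangle_split:
  fixes a b c d m :: real
  assumes "G \<in> sets lebesgue"
  shows "c \<le> m \<Longrightarrow> m \<le> d \<Longrightarrow> measure lebesgue (G \<inter> {a..b} \<times> {c..d})
      = measure lebesgue (G \<inter> {a..b} \<times> {c..m}) + measure lebesgue (G \<inter> {a..b} \<times> {m..d})"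
    and "a \<le> m \<Longrightarrow> m \<le> b \<Longrightarrow> measure lebesgue (G \<inter> {a..b} \<times> {c..d})
      = measure lebesgue (G \<inter> {a..m} \<times> {c..d}) + measure lebesgue (G \<inter> {m..b} \<times> {c..d})"
proof -
  have fm: "G \<inter> {a..b} \<times> {c..d} \<in> lmeasurable" for a b c d :: real
    using assms by (auto intro: lmeasurable_Int_sets)
  have line: "AE z in lebesgue. z \<bullet> i \<noteq> m" if "i \<in> Basis" for i :: "real \<times> real"
    using negligible_standard_hyperplane[OF that, of m]
    by (intro AE_I'[of "{z. z \<bullet> i = m}"]) (auto simp: negligible_iff_null_sets)
  show "measure lebesgue (G \<inter> {a..b} \<times> {c..d})
      = measure lebesgue (G \<inter> {a..b} \<times> {c..m}) + measure lebesgue (G \<inter> {a..b} \<times> {m..d})"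
    if "c \<le> m" "m \<le> d"
  proof -
    have "G \<inter> {a..b} \<times> {c..d} = (G \<inter> {a..b} \<times> {c..m}) \<union> (G \<inter> {a..b} \<times> {m..d})"
      using that by auto
    moreover have "AE z in lebesgue. z \<notin> G \<inter> {a..b} \<times> {c..m} \<or> z \<notin> G \<inter> {a..b} \<times> {m..d}"
      using line[of "(0, 1)"] by (auto simp: Basis_prod_def elim!: eventually_mono)
    ultimately show ?thesis using fm by (simp add: measure_Un_AE)
  qed
  show "measure lebesgue (G \<inter> {a..b} \<times> {c..d})
      = measure lebesgue (G \<inter> {a..m} \<times> {c..d}) + measure lebesgue (G \<inter> {m..b} \<times> {c..d})"
    if "a \<le> m" "m \<le> b"
  proof -
    have "G \<inter> {a..b} \<times> {c..d} = (G \<inter> {a..m} \<times> {c..d}) \<union> (G \<inter> {m..b} \<times> {c..d})"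
      using that by auto
    moreover have "AE z in lebesgue. z \<notin> G \<inter> {a..m} \<times> {c..d} \<or> z \<notin> G \<inter> {m..b} \<times> {c..d}"
      using line[of "(1, 0)"] by (auto simp: Basis_prod_def elim!: eventually_mono)
    ultimately show ?thesis using fm by (simp add: measure_Un_AE)
  qed
qed

text \<open>
  The common lower density \<open>\<eta>\<close> is fixed before the area \<open>\<epsilon>\<close> tends to \<open>0\<close>.
\<close>

definition share_thin_rectangles :: "(real \<times> real) set \<Rightarrow> (real \<times> real) set \<Rightarrow> bool" where
  "share_thin_rectangles G F \<longleftrightarrow> (\<exists>\<eta>>0. \<forall>\<epsilon>>0. \<exists>a b c d. a < b \<and> c < d \<and> (b - a) * (d - c) < \<epsilon> \<and>
     \<eta> * ((b - a) * (d - c)) \<le> measure lebesgue (G \<inter> {a..b} \<times> {c..d}) \<and>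
     \<eta> * ((b - a) * (d - c)) \<le> measure lebesgue (F \<inter> {a..b} \<times> {c..d}))"

text \<open>
  Here \<open>\<phi> c d\<close> and \<open>\<psi> c d\<close> stand for the measures of two sets in strips of widths \<open>w\<close> and \<open>w'\<close> over the
  interval from \<open>c\<close> to \<open>d\<close>. The two relative densities, each at most \<open>1\<close>, add up to at least \<open>5/4\<close>.
  Bisection keeps this sum, and then each of them is at least \<open>1/4\<close>.
\<close>

lemma common_dense_slices:
  fixes \<phi> \<psi> :: "real \<Rightarrow> real \<Rightarrow> real"
  assumes add: "\<And>a m b. \<lbrakk>a \<le> m; m \<le> b\<rbrakk> \<Longrightarrow> \<phi> a b = \<phi> a m + \<phi> m b"
      "\<And>a m b. \<lbrakk>a \<le> m; m \<le> b\<rbrakk> \<Longrightarrow> \<psi> a b = \<psi> a m + \<psi> m b"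
    and le: "\<And>a b. a \<le> b \<Longrightarrow> \<phi> a b \<le> w * (b - a)" "\<And>a b. a \<le> b \<Longrightarrow> \<psi> a b \<le> w' * (b - a)"
    and w: "0 < w" "0 < w'" and "a < b"
    and dense: "1 / 2 * (w * (b - a)) \<le> \<phi> a b" "3 / 4 * (w' * (b - a)) \<le> \<psi> a b" and "0 < \<epsilon>"
  obtains c d where "c < d" "d - c < \<epsilon>" "w / 4 * (d - c) \<le> \<phi> c d" "w' / 4 * (d - c) \<le> \<psi> c d"
proof -
  define \<theta> where "\<theta> u v = \<phi> u v / w + \<psi> u v / w'" for u v
  have "5 / 4 * (b - a) \<le> \<theta> a b"
  proof -
    have "1 / 2 * (b - a) \<le> \<phi> a b / w" "3 / 4 * (b - a) \<le> \<psi> a b / w'"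
      using dense w by (simp_all only: pos_le_divide_eq mult_ac)
    then show ?thesis unfolding \<theta>_def by linarith
  qed
  moreover have "\<theta> u v = \<theta> u m + \<theta> m v" if "u \<le> m" "m \<le> v" for u m v
    using add[OF that] by (simp add: \<theta>_def add_divide_distrib)
  ultimately have ex: "\<exists>c d. c < d \<and> d - c = (b - a) / 2 ^ n \<and> 5 / 4 * (d - c) \<le> \<theta> c d" for n
    by (intro bisection_preserves_density \<open>a < b\<close>)
  obtain n where n: "(b - a) / \<epsilon> < 2 ^ n"
    using real_arch_pow[of 2 "(b - a) / \<epsilon>"] by auto
  obtain c d where cd: "c < d" "d - c = (b - a) / 2 ^ n" "5 / 4 * (d - c) \<le> \<theta> c d"
    using ex by blast
  define X Y where "X = \<phi> c d / w" and "Y = \<psi> c d / w'"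
  have XY: "X \<le> d - c" "Y \<le> d - c" "5 / 4 * (d - c) \<le> X + Y"
    using le[of c d] w cd(1,3) by (simp_all add: X_def Y_def \<theta>_def field_simps)
  have "(d - c) / 4 \<le> X" using XY(2,3) by argo
  then have 1: "w / 4 * (d - c) \<le> \<phi> c d"
    using w(1) by (simp add: X_def field_simps)
  have "(d - c) / 4 \<le> Y" using XY(1,3) by argo
  then have 2: "w' / 4 * (d - c) \<le> \<psi> c d"
    using w(2) by (simp add: Y_def field_simps)
  have "(b - a) / 2 ^ n < \<epsilon>"
    using n \<open>0 < \<epsilon>\<close> by (simp add: pos_divide_less_eq mult.commute)
  with cd(1,2) 1 2 show ?thesis by (intro that[of c d]) auto
qed

lemma measure_rectangle_Int_le:
  fixes a b c d :: real
  assumes "G \<in> sets lebesgue" "a \<le> b" "c \<le> d"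
  shows "measure lebesgue (G \<inter> {a..b} \<times> {c..d}) \<le> (b - a) * (d - c)"
proof -
  have "measure lebesgue (G \<inter> {a..b} \<times> {c..d}) \<le> measure lebesgue ({a..b} \<times> {c..d})"
    using lmeasurable_Int_sets[OF assms(1) lmeasurable_rectangle]
    by (intro measure_mono_fmeasurable) auto
  then show ?thesis using assms by (simp add: measure_rectangle)
qed

lemma measure_rectangle_Int_mono:
  fixes a b c d :: real
  assumes "G \<in> sets lebesgue" "{a..b} \<times> {c..d} \<subseteq> {a'..b'} \<times> {c'..d'}"
  shows "measure lebesgue (G \<inter> {a..b} \<times> {c..d}) \<le> measure lebesgue (G \<inter> {a'..b'} \<times> {c'..d'})"
  using assms(2) lmeasurable_Int_sets[OF assms(1) lmeasurable_rectangle]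
  by (intro measure_mono_fmeasurable) auto

text \<open>
  The rectangles wanted span the hull of the two \<open>x\<close>-intervals and have a short \<open>y\<close>-interval. Their density
  is smaller than that of the slices by the fixed ratio of a width to the width of the hull.
\<close>

lemma share_thin_rectangles_horizontal:
  fixes k1 k2 k1' k2' l1 l2 :: real
  assumes G: "G \<in> sets lebesgue" and F: "F \<in> sets lebesgue"
    and k: "k1 < k2" "k1' < k2'" and l: "l1 < l2"
    and dG: "1 / 2 * ((k2 - k1) * (l2 - l1)) \<le> measure lebesgue (G \<inter> {k1..k2} \<times> {l1..l2})"
    and dF: "3 / 4 * ((k2' - k1') * (l2 - l1)) \<le> measure lebesgue (F \<inter> {k1'..k2'} \<times> {l1..l2})"
  shows "share_thin_rectangles G F"
proof -
  define A B where "A = min k1 k1'" and "B = max k2 k2'"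
  have AB: "A < B" "A \<le> k1" "A \<le> k1'" "k2 \<le> B" "k2' \<le> B" using k by (auto simp: A_def B_def)
  define D where "D = B - A"
  define \<eta> where "\<eta> = min (k2 - k1) (k2' - k1') / (4 * D)"
  have \<eta>: "0 < \<eta>" "\<eta> * (B - A) \<le> (k2 - k1) / 4" "\<eta> * (B - A) \<le> (k2' - k1') / 4"
  proof -
    have "0 < D" using AB(1) by (simp add: D_def)
    then have "\<eta> * D = min (k2 - k1) (k2' - k1') / 4" by (simp add: \<eta>_def)
    then show "0 < \<eta>" "\<eta> * (B - A) \<le> (k2 - k1) / 4" "\<eta> * (B - A) \<le> (k2' - k1') / 4"
      using k \<open>0 < D\<close> by (simp_all add: \<eta>_def D_def[symmetric])
  qed
  have "\<exists>a b c d. a < b \<and> c < d \<and> (b - a) * (d - c) < \<epsilon> \<and>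
     \<eta> * ((b - a) * (d - c)) \<le> measure lebesgue (G \<inter> {a..b} \<times> {c..d}) \<and>
     \<eta> * ((b - a) * (d - c)) \<le> measure lebesgue (F \<inter> {a..b} \<times> {c..d})" if e: "0 < \<epsilon>" for \<epsilon>
  proof -
    obtain c d where cd: "c < d" "d - c < \<epsilon> / (B - A)"
      "(k2 - k1) / 4 * (d - c) \<le> measure lebesgue (G \<inter> {k1..k2} \<times> {c..d})"
      "(k2' - k1') / 4 * (d - c) \<le> measure lebesgue (F \<inter> {k1'..k2'} \<times> {c..d})"
    proof (rule common_dense_slices[of "\<lambda>c d. measure lebesgue (G \<inter> {k1..k2} \<times> {c..d})"
          "\<lambda>c d. measure lebesgue (F \<inter> {k1'..k2'} \<times> {c..d})" "k2 - k1" "k2' - k1'" l1 l2 "\<epsilon> / (B - A)"])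
    qed (use e k l dG dF AB(1) in \<open>auto intro: measure_rectangle_split(1) G F measure_rectangle_Int_le\<close>)
    have "\<eta> * ((B - A) * (d - c)) \<le> measure lebesgue (G \<inter> {A..B} \<times> {c..d})"
    proof -
      have "\<eta> * (B - A) * (d - c) \<le> (k2 - k1) / 4 * (d - c)"
        using \<eta> cd(1) by (intro mult_right_mono) auto
      also note cd(3)
      also have "measure lebesgue (G \<inter> {k1..k2} \<times> {c..d}) \<le> measure lebesgue (G \<inter> {A..B} \<times> {c..d})"
        using AB by (intro measure_rectangle_Int_mono G) auto
      finally show ?thesis by (simp add: mult.assoc)
    qed
    moreover have "\<eta> * ((B - A) * (d - c)) \<le> measure lebesgue (F \<inter> {A..B} \<times> {c..d})"
    proof -
      have "\<eta> * (B - A) * (d - c) \<le> (k2' - k1') / 4 * (d - c)"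
        using \<eta> cd(1) by (intro mult_right_mono) auto
      also note cd(4)
      also have "measure lebesgue (F \<inter> {k1'..k2'} \<times> {c..d}) \<le> measure lebesgue (F \<inter> {A..B} \<times> {c..d})"
        using AB by (intro measure_rectangle_Int_mono F) auto
      finally show ?thesis by (simp add: mult.assoc)
    qed
    moreover have "(B - A) * (d - c) < \<epsilon>"
      using cd(2) AB(1) by (simp add: field_simps)
    ultimately show ?thesis using AB(1) cd(1) by blast
  qed
  with \<eta>(1) show ?thesis unfolding share_thin_rectangles_def by blast
qed

lemma share_thin_rectangles_vertical:
  fixes k1 k2 l1 l2 l1' l2' :: real
  assumes G: "G \<in> sets lebesgue" and F: "F \<in> sets lebesgue"
    and l: "l1 < l2" "l1' < l2'" and k: "k1 < k2"
    and dG: "1 / 2 * ((k2 - k1) * (l2 - l1)) \<le> measure lebesgue (G \<inter> {k1..k2} \<times> {l1..l2})"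
    and dF: "3 / 4 * ((k2 - k1) * (l2' - l1')) \<le> measure lebesgue (F \<inter> {k1..k2} \<times> {l1'..l2'})"
  shows "share_thin_rectangles F G"
proof -
  define A B where "A = min l1 l1'" and "B = max l2 l2'"
  have AB: "A < B" "A \<le> l1" "A \<le> l1'" "l2 \<le> B" "l2' \<le> B" using l by (auto simp: A_def B_def)
  define D where "D = B - A"
  define \<eta> where "\<eta> = min (l2 - l1) (l2' - l1') / (4 * D)"
  have \<eta>: "0 < \<eta>" "\<eta> * (B - A) \<le> (l2 - l1) / 4" "\<eta> * (B - A) \<le> (l2' - l1') / 4"
  proof -
    have "0 < D" using AB(1) by (simp add: D_def)
    then have "\<eta> * D = min (l2 - l1) (l2' - l1') / 4" by (simp add: \<eta>_def)
    then show "0 < \<eta>" "\<eta> * (B - A) \<le> (l2 - l1) / 4" "\<eta> * (B - A) \<le> (l2' - l1') / 4"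
      using l \<open>0 < D\<close> by (simp_all add: \<eta>_def D_def[symmetric])
  qed
  have "\<exists>a b c d. a < b \<and> c < d \<and> (b - a) * (d - c) < \<epsilon> \<and>
     \<eta> * ((b - a) * (d - c)) \<le> measure lebesgue (F \<inter> {a..b} \<times> {c..d}) \<and>
     \<eta> * ((b - a) * (d - c)) \<le> measure lebesgue (G \<inter> {a..b} \<times> {c..d})" if e: "0 < \<epsilon>" for \<epsilon>
  proof -
    obtain a b where ab: "a < b" "b - a < \<epsilon> / (B - A)"
      "(l2 - l1) / 4 * (b - a) \<le> measure lebesgue (G \<inter> {a..b} \<times> {l1..l2})"
      "(l2' - l1') / 4 * (b - a) \<le> measure lebesgue (F \<inter> {a..b} \<times> {l1'..l2'})"
    proof (rule common_dense_slices[of "\<lambda>a b. measure lebesgue (G \<inter> {a..b} \<times> {l1..l2})"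
          "\<lambda>a b. measure lebesgue (F \<inter> {a..b} \<times> {l1'..l2'})" "l2 - l1" "l2' - l1'" k1 k2 "\<epsilon> / (B - A)"])
      show "measure lebesgue (G \<inter> {a..b} \<times> {l1..l2}) \<le> (l2 - l1) * (b - a)" if "a \<le> b" for a b
        using measure_rectangle_Int_le[OF G that, of l1 l2] l by (simp add: mult.commute)
      show "measure lebesgue (F \<inter> {a..b} \<times> {l1'..l2'}) \<le> (l2' - l1') * (b - a)" if "a \<le> b" for a b
        using measure_rectangle_Int_le[OF F that, of l1' l2'] l by (simp add: mult.commute)
    qed (use e k l dG dF AB(1) in \<open>auto intro: measure_rectangle_split(2) G F simp: mult.commute[of "k2 - k1"]\<close>)
    have "\<eta> * ((b - a) * (B - A)) \<le> measure lebesgue (G \<inter> {a..b} \<times> {A..B})"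
    proof -
      have "\<eta> * (B - A) * (b - a) \<le> (l2 - l1) / 4 * (b - a)"
        using \<eta> ab(1) by (intro mult_right_mono) auto
      also note ab(3)
      also have "measure lebesgue (G \<inter> {a..b} \<times> {l1..l2}) \<le> measure lebesgue (G \<inter> {a..b} \<times> {A..B})"
        using AB by (intro measure_rectangle_Int_mono G) auto
      finally show ?thesis by (simp add: mult_ac)
    qed
    moreover have "\<eta> * ((b - a) * (B - A)) \<le> measure lebesgue (F \<inter> {a..b} \<times> {A..B})"
    proof -
      have "\<eta> * (B - A) * (b - a) \<le> (l2' - l1') / 4 * (b - a)"
        using \<eta> ab(1) by (intro mult_right_mono) auto
      also note ab(4)
      also have "measure lebesgue (F \<inter> {a..b} \<times> {l1'..l2'}) \<le> measure lebesgue (F \<inter> {a..b} \<times> {A..B})"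
        using AB by (intro measure_rectangle_Int_mono F) auto
      finally show ?thesis by (simp add: mult_ac)
    qed
    moreover have "(b - a) * (B - A) < \<epsilon>"
      using ab(2) AB(1) by (simp add: field_simps)
    ultimately show ?thesis using AB(1) ab(1) by blast
  qed
  with \<eta>(1) show ?thesis unfolding share_thin_rectangles_def by blast
qed

section \<open>Boundedness forces a constant exponent\<close>

lemma nondeg_interval_Icc: "a < b \<Longrightarrow> nondeg_interval {a..b}"
  by (simp add: nondeg_interval_def is_interval_cc)

lemma lebesgue_sets_level:
  fixes p :: "real \<times> real \<Rightarrow> real"
  assumes "p \<in> borel_measurable lebesgue"
  shows "{z. p z \<le> v} \<in> sets lebesgue" "{z. v \<le> p z} \<in> sets lebesgue"
  using measurable_sets[OF assms, of "{..v}"] measurable_sets[OF assms, of "{v..}"]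
  by (simp_all add: vimage_def)

text \<open>
  The function tested is the indicator of \<open>{p \<le> s} \<inter> R\<close>. Its norm is estimated on a set where \<open>p\<close> is small,
  and the norm of its maximal function is bounded below on a set where \<open>q\<close> is large. As all measures
  are at most \<open>1\<close>, a smaller exponent gives a smaller norm in the first estimate, and a larger
  exponent a larger norm in the second.
\<close>

lemma rectangle_test_inequality:
  fixes p q :: "real \<times> real \<Rightarrow> real" and \<alpha> :: real
  assumes p[measurable]: "p \<in> borel_measurable lebesgue"
    and p1: "\<And>z. 1 < p z" and ap: "\<And>z. \<alpha> * p z < 1" and q: "\<And>z. q z = p z / (1 - \<alpha> * p z)"
    and s: "0 < s" and u: "0 < u" "\<alpha> * u < 1"
    and c: "0 < c" and bd: "\<And>f. f \<in> var_Lp p \<Longrightarrow> var_lux_norm q (strong_frac_maximal \<alpha> f) \<le> ennreal c * var_norm p f"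
    and ab: "x1 < x2" "y1 < y2" and area: "(x2 - x1) * (y2 - y1) \<le> 1"
  defines "R \<equiv> {x1..x2} \<times> {y1..y2}"
  defines "e \<equiv> measure lebesgue ({z. p z \<le> s} \<inter> R)" and "h \<equiv> measure lebesgue ({z. u \<le> p z} \<inter> R)"
  assumes eh: "0 < e" "0 < h"
  shows "((x2 - x1) * (y2 - y1)) powr (\<alpha> - 1) * e * h powr (1 / u - \<alpha>) \<le> c * e powr (1 / s)"
proof -
  define E where "E = {z. p z \<le> s} \<inter> R"
  define F where "F = {z. u \<le> p z} \<inter> R"
  define r where "r = (x2 - x1) * (y2 - y1)"
  have r: "measure lebesgue R = r" "0 < r" "r \<le> 1"
    using ab area by (auto simp: R_def r_def measure_rectangle)
  have Rm: "R \<in> lmeasurable" by (simp add: R_def)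
  have sets: "{z. p z \<le> s} \<in> sets lebesgue" "{z. u \<le> p z} \<in> sets lebesgue"
    by (rule lebesgue_sets_level[OF p])+
  have E: "E \<in> lmeasurable" and F: "F \<in> lmeasurable"
    unfolding E_def F_def by (intro lmeasurable_Int_sets sets Rm)+
  have [measurable]: "E \<in> sets lebesgue" "F \<in> sets lebesgue" using E F by auto
  have eh1: "e \<le> 1" "h \<le> 1"
    using measure_mono_fmeasurable[of E R lebesgue] measure_mono_fmeasurable[of F R lebesgue] Rm r
    by (auto simp: e_def h_def E_def[symmetric] F_def[symmetric]) (auto simp: E_def F_def)
  have emE: "emeasure lebesgue E = ennreal e" and emF: "emeasure lebesgue F = ennreal h"
    using E F by (simp_all add: emeasure_eq_measure2 e_def h_def E_def F_def)
  define t where "t = e powr (1 / s)"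
  have t: "0 < t" "t \<le> 1" "t powr s = e"
    using eh eh1 s by (auto simp: t_def powr_powr intro: powr_le1)
  let ?f = "indicator E :: real \<times> real \<Rightarrow> real"
  have "(\<integral>\<^sup>+ z. ennreal_powr (ennreal \<bar>?f z\<bar> / ennreal t) (p z) \<partial>lebesgue)
      \<le> (\<integral>\<^sup>+ z. ennreal (1 / e) * indicator E z \<partial>lebesgue)"
  proof (rule nn_integral_mono)
    fix z
    show "ennreal_powr (ennreal \<bar>?f z\<bar> / ennreal t) (p z) \<le> ennreal (1 / e) * indicator E z"
    proof (cases "z \<in> E")
      case True
      then have "(1 / t) powr p z \<le> (1 / t) powr s"
        using t by (intro powr_mono) (auto simp: E_def)
      also have "\<dots> = 1 / e" using t by (simp add: powr_divide)
      finally have "(1 / t) powr p z \<le> 1 / e" .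
      moreover have "ennreal \<bar>?f z\<bar> / ennreal t = ennreal (1 / t)"
        using divide_ennreal[of 1 t] True t by simp
      ultimately show ?thesis
        using True t by (simp add: ennreal_powr_ennreal ennreal_leI)
    qed (simp add: ennreal_powr_def)
  qed
  also have "\<dots> = ennreal (1 / e) * ennreal e"
    by (simp add: nn_integral_cmult_indicator emE)
  also have "\<dots> = 1" using eh by (simp add: ennreal_mult'[symmetric])
  finally have "var_norm p ?f \<le> ennreal t"
    unfolding var_norm_def var_lux_norm_def using t by (intro Inf_lower) blast
  moreover then have "?f \<in> var_Lp p"
    unfolding var_Lp_def by (auto intro: le_less_trans)
  ultimately have upper: "var_lux_norm q (strong_frac_maximal \<alpha> ?f) \<le> ennreal (c * t)"
    using bd[of ?f] c mult_left_mono[of "var_norm p ?f" "ennreal t" "ennreal c"]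
    by (auto simp: ennreal_mult' intro: order_trans)
  define v where "v = r powr (\<alpha> - 1) * e"
  have v: "0 < v" using r eh by (simp add: v_def)
  have M: "ennreal v \<le> strong_frac_maximal \<alpha> ?f z" if "z \<in> R" for z
  proof -
    obtain x y where z: "z = (x, y)" by (cases z)
    have "(\<integral>\<^sup>+ z\<in>R. ennreal \<bar>?f z\<bar> \<partial>lebesgue) = (\<integral>\<^sup>+ z. indicator E z \<partial>lebesgue)"
      by (intro nn_integral_cong) (auto simp: indicator_def E_def)
    then have "(\<integral>\<^sup>+ z\<in>R. ennreal \<bar>?f z\<bar> \<partial>lebesgue) = ennreal e" by (simp add: emE)
    then have "ennreal v = ennreal (measure lebesgue R powr (\<alpha> - 1)) * (\<integral>\<^sup>+ z\<in>R. ennreal \<bar>?f z\<bar> \<partial>lebesgue)"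
      using r eh by (simp add: v_def ennreal_mult')
    also have "\<dots> \<le> strong_frac_maximal \<alpha> ?f z"
      unfolding z strong_frac_maximal_def prod.case
    proof (rule Sup_upper, clarify, intro exI conjI)
      show "nondeg_interval {x1..x2}" "nondeg_interval {y1..y2}"
        using ab by (auto intro: nondeg_interval_Icc)
      show "x \<in> {x1..x2}" "y \<in> {y1..y2}" using that by (auto simp: z R_def)
    qed (simp add: R_def)
    finally show ?thesis .
  qed
  define \<beta> where "\<beta> = 1 / u - \<alpha>"
  have \<beta>: "0 < \<beta>" using u by (simp add: \<beta>_def field_simps)
  have "ennreal (v * h powr \<beta>) \<le> var_lux_norm q (strong_frac_maximal \<alpha> ?f)"
    unfolding var_lux_norm_def
  proof (rule Inf_greatest, clarify)
    fix w :: real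
    assume w: "0 < w" and le1: "(\<integral>\<^sup>+ z. ennreal_powr (strong_frac_maximal \<alpha> ?f z / ennreal w) (q z) \<partial>lebesgue) \<le> 1"
    have "v * h powr \<beta> \<le> w"
    proof (rule ccontr)
      assume "\<not> ?thesis"
      then have wv: "w < v * h powr \<beta>" by simp
      have "h powr \<beta> \<le> 1" using eh1 eh \<beta> by (simp add: powr_le1)
      then have "v * h powr \<beta> \<le> v" using v by simp
      then have vw: "1 < v / w" using wv w by simp
      have hv: "h powr (- \<beta>) < v / w"
        using wv w eh by (simp add: powr_minus field_simps)
      have "1 / h = h powr (- 1)"
        using eh by (simp add: powr_minus_divide)
      also have "\<dots> = (h powr (- \<beta>)) powr (1 / \<beta>)"
        unfolding powr_powr using \<beta> by simp
      also have "\<dots> < (v / w) powr (1 / \<beta>)"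
        using hv \<beta> by (intro powr_less_mono2) auto
      finally have big: "1 < (v / w) powr (1 / \<beta>) * h"
        using eh by (simp add: field_simps)
      have "ennreal ((v / w) powr (1 / \<beta>) * h) = (\<integral>\<^sup>+ z. ennreal ((v / w) powr (1 / \<beta>)) * indicator F z \<partial>lebesgue)"
        using eh by (simp add: nn_integral_cmult_indicator emF ennreal_mult')
      also have "\<dots> \<le> (\<integral>\<^sup>+ z. ennreal_powr (strong_frac_maximal \<alpha> ?f z / ennreal w) (q z) \<partial>lebesgue)"
      proof (rule nn_integral_mono)
        fix z
        show "ennreal ((v / w) powr (1 / \<beta>)) * indicator F z \<le> ennreal_powr (strong_frac_maximal \<alpha> ?f z / ennreal w) (q z)"
        proof (cases "z \<in> F")
          case True
          then have z: "u \<le> p z" "z \<in> R" by (auto simp: F_def)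
          have qz: "q z = 1 / (1 / p z - \<alpha>)" "0 < 1 / p z - \<alpha>"
            using p1[of z] ap[of z] by (auto simp: q field_simps)
          have "1 / p z - \<alpha> \<le> \<beta>" using z(1) u by (simp add: \<beta>_def frac_le)
          then have "1 / \<beta> \<le> q z" unfolding qz(1) using qz(2) \<beta> by (intro divide_left_mono) auto
          then have "(v / w) powr (1 / \<beta>) \<le> (v / w) powr q z"
            using vw by (intro powr_mono) auto
          then have "ennreal ((v / w) powr (1 / \<beta>)) \<le> ennreal_powr (ennreal v / ennreal w) (q z)"
            using v w by (simp add: divide_ennreal ennreal_powr_ennreal ennreal_leI)
          also have "\<dots> \<le> ennreal_powr (strong_frac_maximal \<alpha> ?f z / ennreal w) (q z)"
            using M[OF z(2)] qz by (intro ennreal_powr_mono divide_right_mono_ennreal) auto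
          finally show ?thesis using True by simp
        qed simp
      qed
      also note le1
      finally show False using big by simp
    qed
    then show "ennreal (v * h powr \<beta>) \<le> ennreal w" by (rule ennreal_leI)
  qed
  also note upper
  finally have "v * h powr \<beta> \<le> c * t"
    using c t by (simp add: ennreal_le_iff)
  then show ?thesis by (simp add: v_def \<beta>_def t_def r_def)
qed

lemma share_thin_rectangles_imp_unbounded:
  fixes p q :: "real \<times> real \<Rightarrow> real" and \<alpha> :: real
  assumes p: "p \<in> borel_measurable lebesgue"
    and p1: "\<And>z. 1 < p z" and ap: "\<And>z. \<alpha> * p z < 1" and q: "\<And>z. q z = p z / (1 - \<alpha> * p z)" and a: "0 \<le> \<alpha>"
    and s: "0 < s" "s < u"
    and thin: "share_thin_rectangles {z. p z \<le> s} {z. u \<le> p z}"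
  shows "\<not> strong_frac_maximal_bounded \<alpha> p q"
proof
  assume "strong_frac_maximal_bounded \<alpha> p q"
  then obtain c where c: "0 < c" and bd: "\<And>f. f \<in> var_Lp p \<Longrightarrow> var_lux_norm q (strong_frac_maximal \<alpha> f) \<le> ennreal c * var_norm p f"
    unfolding strong_frac_maximal_bounded_def by blast
  obtain \<eta> where \<eta>: "0 < \<eta>" and ex: "\<And>\<epsilon>. 0 < \<epsilon> \<Longrightarrow> \<exists>a b c d. a < b \<and> c < d \<and> (b - a) * (d - c) < \<epsilon> \<and>
     \<eta> * ((b - a) * (d - c)) \<le> measure lebesgue ({z. p z \<le> s} \<inter> {a..b} \<times> {c..d}) \<and>
     \<eta> * ((b - a) * (d - c)) \<le> measure lebesgue ({z. u \<le> p z} \<inter> {a..b} \<times> {c..d})"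
    using thin unfolding share_thin_rectangles_def by metis
  define \<delta> where "\<delta> = 1 / s - 1 / u"
  have \<delta>: "0 < \<delta>" using s by (simp add: \<delta>_def field_simps)
  \<comment> \<open>comparing powers of the area \<open>r\<close> in the test inequality gives \<open>\<gamma> \<le> r powr \<delta>\<close>, which fails for small \<open>r\<close>\<close>
  define \<gamma> where "\<gamma> = \<eta> powr (1 + (1 / u - \<alpha>)) / c"
  have \<gamma>: "0 < \<gamma>" using \<eta> c by (simp add: \<gamma>_def)
  define \<epsilon> where "\<epsilon> = min 1 (\<gamma> powr (1 / \<delta>))"
  have \<epsilon>: "0 < \<epsilon>" using \<gamma> by (simp add: \<epsilon>_def)
  obtain x1 x2 y1 y2 where R: "x1 < x2" "y1 < y2" "(x2 - x1) * (y2 - y1) < \<epsilon>"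
     "\<eta> * ((x2 - x1) * (y2 - y1)) \<le> measure lebesgue ({z. p z \<le> s} \<inter> {x1..x2} \<times> {y1..y2})"
     "\<eta> * ((x2 - x1) * (y2 - y1)) \<le> measure lebesgue ({z. u \<le> p z} \<inter> {x1..x2} \<times> {y1..y2})"
    using ex[OF \<epsilon>] by blast
  define r where "r = (x2 - x1) * (y2 - y1)"
  define e where "e = measure lebesgue ({z. p z \<le> s} \<inter> {x1..x2} \<times> {y1..y2})"
  define h where "h = measure lebesgue ({z. u \<le> p z} \<inter> {x1..x2} \<times> {y1..y2})"
  have r: "0 < r" "r \<le> 1" "r < \<gamma> powr (1 / \<delta>)"
    using R by (auto simp: r_def \<epsilon>_def)
  have eh: "\<eta> * r \<le> e" "\<eta> * r \<le> h" "0 < \<eta> * r" using R(4,5) \<eta> r by (auto simp: e_def h_def r_def)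
  then have eh0: "0 < e" "0 < h" by linarith+
  have er: "e \<le> r"
    unfolding e_def r_def using R(1,2) by (intro measure_rectangle_Int_le lebesgue_sets_level p) auto
  obtain z where "u \<le> p z"
    using eh0(2) unfolding h_def by (cases "{z. u \<le> p z} = {}") auto
  then have "\<alpha> * u \<le> \<alpha> * p z" using a by (intro mult_left_mono)
  with ap[of z] have u: "\<alpha> * u < 1" by linarith
  have \<beta>: "0 < 1 / u - \<alpha>" using u s by (simp add: field_simps)
  have "r powr (\<alpha> - 1) * (\<eta> * r) * (\<eta> * r) powr (1 / u - \<alpha>) \<le> r powr (\<alpha> - 1) * e * h powr (1 / u - \<alpha>)"
    using eh eh0 r \<beta> by (intro mult_mono[OF mult_left_mono] powr_mono2) auto
  also have "\<dots> \<le> c * e powr (1 / s)"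
    using rectangle_test_inequality[OF p p1 ap q s(1) _ u c bd R(1,2)] s eh0 r(2)
    unfolding e_def h_def r_def by auto
  also have "\<dots> \<le> c * r powr (1 / s)"
    using er eh0 c s by (intro mult_left_mono powr_mono2) auto
  also have "r powr (\<alpha> - 1) * (\<eta> * r) * (\<eta> * r) powr (1 / u - \<alpha>) = \<eta> powr (1 + (1 / u - \<alpha>)) * r powr (1 / u)"
  proof -
    have "r powr (\<alpha> - 1) * (\<eta> * r) * (\<eta> * r) powr (1 / u - \<alpha>)
        = (\<eta> powr 1 * \<eta> powr (1 / u - \<alpha>)) * (r powr (\<alpha> - 1) * r powr 1 * r powr (1 / u - \<alpha>))"
      using \<eta> r by (simp add: powr_mult)
    also have "r powr (\<alpha> - 1) * r powr 1 * r powr (1 / u - \<alpha>) = r powr (1 / u)"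
      unfolding powr_add[symmetric] by simp
    finally show ?thesis by (simp only: powr_add)
  qed
  finally have "\<eta> powr (1 + (1 / u - \<alpha>)) * r powr (1 / u) \<le> c * (r powr \<delta> * r powr (1 / u))"
    by (simp add: \<delta>_def powr_add[symmetric])
  then have "\<gamma> \<le> r powr \<delta>"
    using c r by (simp add: \<gamma>_def field_simps)
  also have "\<dots> < (\<gamma> powr (1 / \<delta>)) powr \<delta>"
    using r \<delta> by (intro powr_less_mono2) auto
  also have "\<dots> = \<gamma>" using \<gamma> \<delta> by (simp add: powr_powr)
  finally show False by simp
qed

text \<open>
  Otherwise \<open>p\<close> equals its essential infimum \<open>k\<close> almost everywhere: for \<open>k < s < t\<close> the bound \<open>p > s\<close> fails
  on a set of positive measure, hence \<open>p < t\<close> almost everywhere.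
\<close>

lemma not_AE_const_imp_gap:
  fixes p :: "'a \<Rightarrow> real"
  assumes bounds: "\<And>z. l \<le> p z" "\<And>z. p z \<le> P" and nc: "\<nexists>k. AE z in M. p z = k"
  obtains s t where "l \<le> s" "s < t" "\<not> (AE z in M. s < p z)" "\<not> (AE z in M. p z < t)"
proof -
  have "\<exists>s t. l \<le> s \<and> s < t \<and> \<not> (AE z in M. s < p z) \<and> \<not> (AE z in M. p z < t)"
  proof (rule ccontr)
    assume "\<not> ?thesis"
    then have dich: "(AE z in M. s < p z) \<or> (AE z in M. p z < t)" if "l \<le> s" "s < t" for s t
      using that by blast
    define S where "S = {s. AE z in M. s \<le> p z}"
    have lS: "l \<in> S" using bounds by (simp add: S_def)
    have ne: "\<not> (AE z in M. False)"
    proof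
      assume "AE z in M. False"
      then have "AE z in M. p z = 0" by (rule eventually_mono) simp
      then show False using nc by blast
    qed
    have bS: "bdd_above S"
    proof (rule bdd_aboveI)
      fix s assume "s \<in> S"
      show "s \<le> P"
      proof (rule ccontr)
        assume "\<not> s \<le> P"
        then have "AE z in M. False"
          using \<open>s \<in> S\<close> bounds(2) unfolding S_def by (auto elim!: eventually_mono intro: order_trans)
        then show False using ne by simp
      qed
    qed
    define k where "k = Sup S"
    have lk: "l \<le> k" using lS bS by (simp add: k_def cSup_upper)
    have low: "AE z in M. k - 1 / Suc n \<le> p z" for n
    proof -
      have "k - 1 / Suc n < Sup S" by (simp add: k_def)
      then obtain s where "s \<in> S" "k - 1 / Suc n < s"
        using less_cSupD[of S] lS by blast
      then show ?thesis unfolding S_def by (auto elim!: eventually_mono)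
    qed
    have up: "AE z in M. p z < k + 1 / Suc n" for n
    proof -
      define \<epsilon> where "\<epsilon> = 1 / real (Suc n)"
      define s where "s = k + \<epsilon> / 2"
      have "0 < \<epsilon>" by (simp add: \<epsilon>_def)
      then have s: "k < s" "s < k + \<epsilon>" by (simp_all add: s_def)
      have "\<not> (AE z in M. s < p z)"
      proof
        assume "AE z in M. s < p z"
        then have "s \<in> S" unfolding S_def by (auto elim!: eventually_mono)
        then show False using cSup_upper[OF _ bS] s(1) unfolding k_def by fastforce
      qed
      then show ?thesis using dich[of s "k + \<epsilon>"] s lk by (auto simp: \<epsilon>_def)
    qed
    have "AE z in M. \<forall>n. k - 1 / Suc n \<le> p z \<and> p z < k + 1 / Suc n"
      using low up by (simp add: AE_all_countable)
    then have "AE z in M. p z = k"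
    proof eventually_elim
      case (elim z)
      show ?case
      proof (rule ccontr)
        assume "p z \<noteq> k"
        then have "0 < \<bar>p z - k\<bar>" by simp
        then obtain n where "1 / Suc n < \<bar>p z - k\<bar>"
          using reals_Archimedean[of "\<bar>p z - k\<bar>"] by (auto simp: inverse_eq_divide)
        moreover have "k - 1 / Suc n \<le> p z" "p z < k + 1 / Suc n" using elim by blast+
        ultimately show False by linarith
      qed
    qed
    with nc show False by blast
  qed
  then show ?thesis using that by blast
qed

text \<open>
  The corner rectangle \<open>?Q\<close> shares its \<open>x\<close>-interval with the rectangle dense in \<open>{p \<le> s}\<close> and its
  \<open>y\<close>-interval with the one dense in \<open>{p \<ge> t}\<close>. Whichever side of the midpoint \<open>m\<close> dominates in it is
  paired with the set on the far side of the gap.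
\<close>

lemma strong_frac_maximal_bounded_imp_const:
  fixes p q :: "real \<times> real \<Rightarrow> real" and \<alpha> P :: real
  assumes p: "p \<in> borel_measurable lebesgue"
    and p1: "\<And>z. 1 < p z" and pP: "\<And>z. p z \<le> P" and a: "0 \<le> \<alpha>" and ap: "\<And>z. \<alpha> * p z < 1"
    and q: "\<And>z. q z = p z / (1 - \<alpha> * p z)" and bd: "strong_frac_maximal_bounded \<alpha> p q"
  shows "\<exists>k. AE z in lebesgue. p z = k"
proof (rule ccontr)
  assume nc: "\<nexists>k. AE z in lebesgue. p z = k"
  obtain s t where st: "1 \<le> s" "s < t" "\<not> (AE z in lebesgue. s < p z)" "\<not> (AE z in lebesgue. p z < t)"
    using not_AE_const_imp_gap[of 1 p P lebesgue] p1 pP nc by (metis less_imp_le)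
  define m where "m = (s + t) / 2"
  have m: "s < m" "m < t" using st(2) by (auto simp: m_def)
  have no: "\<not> share_thin_rectangles {z. p z \<le> s'} {z. u \<le> p z}" if "1 \<le> s'" "s' < u" for s' u
    using share_thin_rectangles_imp_unbounded[OF p p1 ap q a _ that(2)] that bd by auto
  have sets: "{z. p z \<le> v} \<in> sets lebesgue" "{z. v \<le> p z} \<in> sets lebesgue" for v
    by (rule lebesgue_sets_level[OF p])+
  have nE: "\<not> negligible {z. p z \<le> s}"
    using st(3) by (auto simp: negligible_iff_null_sets AE_iff_null_sets sets not_less[symmetric] dest: AE_not_in)
  have nF: "\<not> negligible {z. t \<le> p z}"
    using st(4) by (auto simp: negligible_iff_null_sets AE_iff_null_sets sets not_less[symmetric] dest: AE_not_in)
  obtain k1 k2 l1 l2 where E: "k1 < k2" "l1 < l2"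
    "3 / 4 * ((k2 - k1) * (l2 - l1)) \<le> measure lebesgue ({z. p z \<le> s} \<inter> {k1..k2} \<times> {l1..l2})"
    using density_rectangle[OF sets(1) nE] .
  obtain k1' k2' l1' l2' where F: "k1' < k2'" "l1' < l2'"
    "3 / 4 * ((k2' - k1') * (l2' - l1')) \<le> measure lebesgue ({z. t \<le> p z} \<inter> {k1'..k2'} \<times> {l1'..l2'})"
    using density_rectangle[OF sets(2) nF] .
  let ?Q = "{k1..k2} \<times> {l1'..l2'}"
  have "(k2 - k1) * (l2' - l1') = measure lebesgue ?Q"
    using E F by (simp add: measure_rectangle)
  also have "?Q = ({z. p z \<le> m} \<inter> ?Q) \<union> ({z. m \<le> p z} \<inter> ?Q)" by auto
  also have "measure lebesgue \<dots> \<le> measure lebesgue ({z. p z \<le> m} \<inter> ?Q) + measure lebesgue ({z. m \<le> p z} \<inter> ?Q)"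
    by (intro measure_Un_le sets.Int sets fmeasurableD lmeasurable_rectangle)
  finally consider "1 / 2 * ((k2 - k1) * (l2' - l1')) \<le> measure lebesgue ({z. p z \<le> m} \<inter> ?Q)"
    | "1 / 2 * ((k2 - k1) * (l2' - l1')) \<le> measure lebesgue ({z. m \<le> p z} \<inter> ?Q)" by linarith
  then show False
  proof cases
    case 1
    then have "share_thin_rectangles {z. p z \<le> m} {z. t \<le> p z}"
      using E F by (intro share_thin_rectangles_horizontal sets)
    then show False using no[of m t] m st by auto
  next
    case 2
    then have "share_thin_rectangles {z. p z \<le> s} {z. m \<le> p z}"
      using E F by (intro share_thin_rectangles_vertical sets)
    then show False using no[of s m] m st by auto
  qed
qed

lemma exponent_bounds:
  fixes p :: "real \<times> real \<Rightarrow> real"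
  assumes "1 < exponent_inf p" "exponent_sup p < \<infinity>" "0 \<le> \<alpha>" "ereal \<alpha> < 1 / exponent_sup p"
  obtains P where "\<And>z. 1 < p z" "\<And>z. p z \<le> P" "\<And>z. \<alpha> * p z < 1"
proof -
  have lo: "1 < p z" for z
  proof -
    have "exponent_inf p \<le> ereal (p z)"
      unfolding exponent_inf_def by (rule INF_lower) simp
    with assms(1) have "1 < ereal (p z)" by (rule less_le_trans)
    then show ?thesis by simp
  qed
  have up: "ereal (p z) \<le> exponent_sup p" for z
    unfolding exponent_sup_def by (rule SUP_upper) simp
  obtain P where P: "exponent_sup p = ereal P"
    using assms(2) up[of 0] by (cases "exponent_sup p") auto
  have hi: "p z \<le> P" for z using up[of z] P by simp
  have "1 < P" using lo[of 0] hi[of 0] by simp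
  then have "\<alpha> * P < 1" using assms(4) P by (simp add: one_ereal_def field_simps)
  then have "\<alpha> * p z < 1" for z
    using mult_left_mono[OF hi[of z] assms(3)] by simp
  with lo hi show ?thesis by (rule that)
qed

theorem mainTheorem1:
  fixes p q :: "real \<times> real \<Rightarrow> real" and \<alpha> :: real
  assumes "p \<in> borel_measurable lebesgue"
    and "1 < exponent_inf p" and "exponent_inf p \<le> exponent_sup p" and "exponent_sup p < \<infinity>"
    and "0 \<le> \<alpha>" and "ereal \<alpha> < 1 / exponent_sup p"
    and "\<And>z. q z = p z / (1 - \<alpha> * p z)"
  shows "strong_frac_maximal_bounded \<alpha> p q \<longleftrightarrow> (\<exists>k. AE z in lebesgue. p z = k)"
proof -
  obtain P where P: "\<And>z. 1 < p z" "\<And>z. p z \<le> P" "\<And>z. \<alpha> * p z < 1"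
    using exponent_bounds[OF assms(2,4,5,6)] by blast
  show ?thesis
  proof
    assume "strong_frac_maximal_bounded \<alpha> p q"
    then show "\<exists>k. AE z in lebesgue. p z = k"
      by (rule strong_frac_maximal_bounded_imp_const[OF assms(1) P(1,2) assms(5) P(3) assms(7)])
  next
    assume "\<exists>k. AE z in lebesgue. p z = k"
    then obtain k where k: "AE z in lebesgue. p z = k" by blast
    have "\<not> (AE z :: real \<times> real in lebesgue. False)"
      by (simp add: AE_iff_measurable[OF _ refl])
    moreover have "AE z :: real \<times> real in lebesgue. False" if "\<forall>z. p z \<noteq> k"
      using k by (rule eventually_mono) (use that in blast)
    ultimately obtain z where "p z = k" by blast
    with P(1,3)[of z] have k1: "1 < k" "\<alpha> * k < 1" by auto
    have "AE z in lebesgue. q z = k / (1 - \<alpha> * k)"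
      using k by eventually_elim (simp add: assms(7))
    then show "strong_frac_maximal_bounded \<alpha> p q"
      by (rule strong_frac_maximal_bounded_const[OF k1(1) assms(5) k1(2) k])
  qed
qed

end
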